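(* Let $G=(V,E)$ be a countable graph of bounded degree which is walk-regular. Then every vertex $v\in V$ is dominant.
   Context: A graph $G=(V,E)$ has a (nonempty) countable (finite or infinite) vertex set $V$ and edge set $E$, a set of unordered pairs $\{v,w\}$ of distinct vertices; it has bounded degree if there is a constant bounding the number of edges incident to every vertex. $G$ is walk-regular if for every $n\ge 0$ the number of closed walks of length $n$ starting and ending at a vertex $v$ is independent of $v$; equivalently, for every $n\ge0$ all diagonal matrix coefficients $\langle A^n\delta_v\mid\delta_v\rangle$ are equal. Here the adjacency operator $A$ is the bounded self-adjoint operator on the complex Hilbert space $\ell^2(V)$ given by $(A\xi)(v)=\sum_{w:\{v,w\}\in E}\xi(w)$, and $\delta_v$ is the characteristic function of $\{v\}$. With $\Sigma(A)$ the spectrum of $A$, the local spectral measure $\mu_\xi$ of $A$ at $\xi\in\ell^2(V)$ is the finite positive Borel measure on $\Sigma(A)$ with $\int f\,d\mu_\xi=\langle f(A)\xi\mid\xi\rangle$ for all continuous $f:\Sigma(A)\to\mathbf{C}$. A vertex $v$ is dominant if for every $\eta\in\ell^2(V)$ the measure $\mu_\eta$ is absolutely continuous with respect to $\mu_{\delta_v}$. *)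

theory Defs
  imports "HOL-Analysis.Analysis" "HOL-Computational_Algebra.Polynomial"
begin

section \<open>Graphs\<close>

definition countable_graph :: "'a set \<Rightarrow> 'a set set \<Rightarrow> bool" where
  "countable_graph V E \<longleftrightarrow>
     V \<noteq> {} \<and> countable V \<and> E \<subseteq> {{v, w} | v w. v \<in> V \<and> w \<in> V \<and> v \<noteq> w}"

text \<open>The finiteness conjunct is needed because \<open>card\<close> is \<open>0\<close> on infinite sets.\<close>

definition bounded_degree :: "'a set \<Rightarrow> 'a set set \<Rightarrow> bool" where
  "bounded_degree V E \<longleftrightarrow>
     (\<exists>d::nat. \<forall>v\<in>V. finite {e \<in> E. v \<in> e} \<and> card {e \<in> E. v \<in> e} \<le> d)"

text \<open>A walk of length \<open>n\<close> is the list of its \<open>n + 1\<close> successive vertices.\<close>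

definition closed_walks :: "'a set \<Rightarrow> 'a set set \<Rightarrow> nat \<Rightarrow> 'a \<Rightarrow> 'a list set" where
  "closed_walks V E n v =
     {p. length p = Suc n \<and> set p \<subseteq> V \<and> hd p = v \<and> last p = v \<and>
         (\<forall>i<n. {p ! i, p ! Suc i} \<in> E)}"

definition walk_regular :: "'a set \<Rightarrow> 'a set set \<Rightarrow> bool" where
  "walk_regular V E \<longleftrightarrow>
     (\<forall>n. \<forall>v\<in>V. \<forall>w\<in>V. card (closed_walks V E n v) = card (closed_walks V E n w))"

section \<open>The Hilbert space of square-summable functions and its operators\<close>

text \<open>Elements are functions on the whole type that vanish outside \<open>V\<close>, so that
  equality in the Hilbert space is equality of functions.\<close>

definition ell2 :: "'a set \<Rightarrow> ('a \<Rightarrow> complex) set" where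
  "ell2 V = {f. (\<forall>v. v \<notin> V \<longrightarrow> f v = 0) \<and> (\<lambda>v. (cmod (f v))\<^sup>2) summable_on V}"

definition ell2_inner :: "'a set \<Rightarrow> ('a \<Rightarrow> complex) \<Rightarrow> ('a \<Rightarrow> complex) \<Rightarrow> complex" where
  "ell2_inner V f g = (\<Sum>\<^sub>\<infinity>v\<in>V. f v * cnj (g v))"

definition ell2_norm :: "'a set \<Rightarrow> ('a \<Rightarrow> complex) \<Rightarrow> real" where
  "ell2_norm V f = sqrt (\<Sum>\<^sub>\<infinity>v\<in>V. (cmod (f v))\<^sup>2)"

definition delta :: "'a \<Rightarrow> 'a \<Rightarrow> complex" where
  "delta v = (\<lambda>w. if w = v then 1 else 0)"

text \<open>Operators are functions of which only the values on \<open>ell2 V\<close> matter.\<close>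

type_synonym 'a operator = "('a \<Rightarrow> complex) \<Rightarrow> 'a \<Rightarrow> complex"

definition bounded_operator :: "'a set \<Rightarrow> 'a operator \<Rightarrow> bool" where
  "bounded_operator V T \<longleftrightarrow>
     (\<forall>f\<in>ell2 V. T f \<in> ell2 V) \<and>
     (\<forall>f\<in>ell2 V. \<forall>g\<in>ell2 V. T (\<lambda>v. f v + g v) = (\<lambda>v. T f v + T g v)) \<and>
     (\<forall>c. \<forall>f\<in>ell2 V. T (\<lambda>v. c * f v) = (\<lambda>v. c * T f v)) \<and>
     (\<exists>C. \<forall>f\<in>ell2 V. ell2_norm V (T f) \<le> C * ell2_norm V f)"

definition operator_norm :: "'a set \<Rightarrow> 'a operator \<Rightarrow> real" where
  "operator_norm V T = (SUP f\<in>{f \<in> ell2 V. ell2_norm V f \<le> 1}. ell2_norm V (T f))"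

definition adjacency_operator :: "'a set \<Rightarrow> 'a set set \<Rightarrow> 'a operator" where
  "adjacency_operator V E f =
     (\<lambda>v. if v \<in> V then (\<Sum>w | w \<in> V \<and> {v, w} \<in> E. f w) else 0)"

definition spectrum :: "'a set \<Rightarrow> 'a operator \<Rightarrow> complex set" where
  "spectrum V T =
     {z. \<not> (\<exists>R. bounded_operator V R \<and>
              (\<forall>f\<in>ell2 V. R (\<lambda>v. T f v - z * f v) = f \<and>
                          (\<lambda>v. T (R f) v - z * R f v) = f))}"

section \<open>Continuous functional calculus and local spectral measures\<close>

definition poly_operator :: "complex poly \<Rightarrow> 'a operator \<Rightarrow> 'a operator" where
  "poly_operator p T f = (\<lambda>v. \<Sum>i\<le>degree p. coeff p i * (T ^^ i) f v)"

text \<open>For a bounded self-adjoint operator \<open>T\<close> (whose spectrum is a compact set of real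
  numbers) and \<open>h\<close> continuous on the spectrum, \<open>h(T)\<close> is the norm limit of \<open>p\<^sub>n(T)\<close> for any
  polynomials \<open>p\<^sub>n\<close> converging to \<open>h\<close> uniformly on the spectrum. This determines the values
  of \<open>h(T)\<close> on \<open>ell2 V\<close>; those elsewhere are arbitrary, hence \<open>SOME\<close> rather than \<open>THE\<close>.\<close>

definition functional_calculus ::
    "'a set \<Rightarrow> 'a operator \<Rightarrow> (complex \<Rightarrow> complex) \<Rightarrow> 'a operator" where
  "functional_calculus V T h =
     (SOME S. bounded_operator V S \<and>
        (\<forall>p :: nat \<Rightarrow> complex poly.
           uniform_limit (spectrum V T) (\<lambda>n. poly (p n)) h sequentially \<longrightarrow>
           (\<lambda>n. operator_norm V (\<lambda>f v. poly_operator (p n) T f v - S f v)) \<longlonglongrightarrow> 0))"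

definition is_local_spectral_measure ::
    "'a set \<Rightarrow> 'a operator \<Rightarrow> ('a \<Rightarrow> complex) \<Rightarrow> complex measure \<Rightarrow> bool" where
  "is_local_spectral_measure V T \<xi> \<mu> \<longleftrightarrow>
     sets \<mu> = sets (restrict_space borel (spectrum V T)) \<and> finite_measure \<mu> \<and>
     (\<forall>h. continuous_on (spectrum V T) h \<longrightarrow>
        integral\<^sup>L \<mu> h = ell2_inner V (functional_calculus V T h \<xi>) \<xi>)"

definition local_spectral_measure ::
    "'a set \<Rightarrow> 'a operator \<Rightarrow> ('a \<Rightarrow> complex) \<Rightarrow> complex measure" where
  "local_spectral_measure V T \<xi> = (THE \<mu>. is_local_spectral_measure V T \<xi> \<mu>)"

text \<open>Pitfall: \<open>absolutely_continuous M N\<close> says that \<open>N\<close> is absolutely continuous with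
  respect to \<open>M\<close>.\<close>

definition dominant :: "'a set \<Rightarrow> 'a set set \<Rightarrow> 'a \<Rightarrow> bool" where
  "dominant V E v \<longleftrightarrow>
     (\<forall>\<eta>\<in>ell2 V. absolutely_continuous
        (local_spectral_measure V (adjacency_operator V E) (delta v))
        (local_spectral_measure V (adjacency_operator V E) \<eta>))"

end

theory Submission
  imports
    Defs
    "HOL-Probability.Probability"
    "HOL-Computational_Algebra.Fundamental_Theorem_Algebra"
begin

text \<open>
  By walk-regularity the moments \<open>\<langle>A\<^sup>n \<delta>\<^sub>v | \<delta>\<^sub>v\<rangle>\<close> do not depend on \<open>v\<close>, so all the measures
  \<open>\<mu>\<close> at the vectors \<open>\<delta>\<^sub>v\<close> coincide. For a Borel set \<open>N\<close> the vectors \<open>\<xi>\<close> with \<open>\<mu>\<^sub>\<xi>(N) = 0\<close> form a closed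
  subspace: the parallelogram law \<open>\<mu>\<^sub>\<xi>\<^sub>+\<^sub>\<eta> + \<mu>\<^sub>\<xi>\<^sub>-\<^sub>\<eta> = 2\<mu>\<^sub>\<xi> + 2\<mu>\<^sub>\<eta>\<close> gives stability under addition, and
  together with \<open>\<mu>\<^sub>\<xi>(N) \<le> \<parallel>\<xi>\<parallel>\<^sup>2\<close> stability under limits. If \<open>N\<close> is null for one vertex it is null for
  all of them, so this subspace is the whole space.

  The local spectral measures are obtained from the moment problem: \<open>p \<mapsto> \<langle>p(A) \<xi> | \<xi>\<rangle>\<close> is positive
  because \<open>\<parallel>p(A)\<parallel>\<close> is bounded by the supremum of \<open>p\<close> on the spectrum, and a positive functional on
  polynomials is represented by the weak limit of the discrete measures with the values on the
  Bernstein polynomials as weights.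
\<close>

section \<open>The Hilbert space\<close>

text \<open>The definitions rest on \<open>SOME\<close> and \<open>THE\<close>, so nothing is known
  about the measures until the functional calculus is shown to exist and the measures to be unique.
  The crux is the supremum bound for \<open>p(T)\<close>. The spectrum is defined by two-sided
  bounded inverses, while the available estimates are lower bounds
  \<open>c * ell2_norm V f \<le> ell2_norm V (p(T) f)\<close>. The bridge is normality: the adjoint
  of a polynomial in a self-adjoint \<open>T\<close> is again a polynomial in \<open>T\<close>, so a
  lower bound already yields surjectivity. Lower bounds for general polynomials then come from
  factoring over the complex numbers. An empty spectrum cannot be ruled out beforehand and needs its
  own argument. Uniqueness, scaling and the parallelogram law are all linear relations between
  finitely many measures, so one passage from continuous functions to Borel sets,
  \<open>measure_combination_eq_0\<close>, serves for all of them. Moments determine a measure on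
  the reals, whereas the definition asks for one on a subset of the complex plane; the two are
  joined by pushing forward along the embedding.\<close>

lemma ell2_outside: "f \<in> ell2 V \<Longrightarrow> v \<notin> V \<Longrightarrow> f v = 0"
  by (simp add: ell2_def)

lemma ell2_summable: "f \<in> ell2 V \<Longrightarrow> (\<lambda>v. (cmod (f v))\<^sup>2) summable_on V"
  by (simp add: ell2_def)

lemma ell2_zero [simp]: "(\<lambda>v. 0) \<in> ell2 V"
  by (simp add: ell2_def)

lemma ell2_scale [simp]: "f \<in> ell2 V \<Longrightarrow> (\<lambda>v. c * f v) \<in> ell2 V"
  by (auto simp: ell2_def norm_mult power_mult_distrib intro: summable_on_cmult_right)

lemma ell2_add [simp]:
  assumes "f \<in> ell2 V" "g \<in> ell2 V"
  shows "(\<lambda>v. f v + g v) \<in> ell2 V"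
proof -
  have bd: "(cmod (a + b))\<^sup>2 \<le> 2 * (cmod a)\<^sup>2 + 2 * (cmod b)\<^sup>2" for a b :: complex
  proof -
    have "(cmod (a + b))\<^sup>2 \<le> (cmod a + cmod b)\<^sup>2"
      by (intro power_mono norm_triangle_ineq) auto
    also have "\<dots> \<le> 2 * (cmod a)\<^sup>2 + 2 * (cmod b)\<^sup>2"
      using sum_squares_bound[of "cmod a" "cmod b"] by (simp add: power2_sum)
    finally show ?thesis .
  qed
  have "(\<lambda>v. 2 * (cmod (f v))\<^sup>2 + 2 * (cmod (g v))\<^sup>2) summable_on V"
    using assms by (intro summable_on_add summable_on_cmult_right) (auto simp: ell2_def)
  then have "(\<lambda>v. (cmod (f v + g v))\<^sup>2) summable_on V"
    by (rule summable_on_comparison_test) (auto simp: bd)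
  then show ?thesis
    using assms by (auto simp: ell2_def)
qed

lemma ell2_diff [simp]:
  assumes "f \<in> ell2 V" "g \<in> ell2 V"
  shows "(\<lambda>v. f v - g v) \<in> ell2 V"
  using ell2_add[OF assms(1) ell2_scale[OF assms(2), of "-1"]] by simp

lemma ell2_sum [simp]:
  "(\<And>i. i \<in> I \<Longrightarrow> f i \<in> ell2 V) \<Longrightarrow> (\<lambda>v. \<Sum>i\<in>I. f i v) \<in> ell2 V"
  by (induction I rule: infinite_finite_induct) auto

lemma ell2_finite_support:
  assumes "finite F" "F \<subseteq> V" "\<And>v. v \<notin> F \<Longrightarrow> f v = 0"
  shows "f \<in> ell2 V"
proof -
  have "(\<lambda>v. (cmod (f v))\<^sup>2) summable_on F"
    using assms by simp
  then have "(\<lambda>v. (cmod (f v))\<^sup>2) summable_on V"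
    by (rule summable_on_cong_neutral[THEN iffD1, rotated -1]) (use assms in auto)
  then show ?thesis
    using assms by (auto simp: ell2_def)
qed

lemma ell2_delta: "v \<in> V \<Longrightarrow> delta v \<in> ell2 V"
  by (rule ell2_finite_support[of "{v}"]) (auto simp: delta_def)

section \<open>Inner product and Cauchy-Schwarz inequality\<close>

lemma ell2_inner_summable:
  assumes "f \<in> ell2 V" "g \<in> ell2 V"
  shows "(\<lambda>v. f v * cnj (g v)) summable_on V"
proof -
  have "(\<lambda>v. (cmod (f v))\<^sup>2 + (cmod (g v))\<^sup>2) summable_on V"
    using assms by (intro summable_on_add) (auto simp: ell2_def)
  then have "(\<lambda>v. norm (f v * cnj (g v))) summable_on V"
  proof (rule summable_on_comparison_test)
    fix v
    have "2 * (cmod (f v) * cmod (g v)) \<le> (cmod (f v))\<^sup>2 + (cmod (g v))\<^sup>2"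
      using sum_squares_bound[of "cmod (f v)" "cmod (g v)"] by simp
    then show "norm (f v * cnj (g v)) \<le> (cmod (f v))\<^sup>2 + (cmod (g v))\<^sup>2"
      using mult_nonneg_nonneg[OF norm_ge_zero[of "f v"] norm_ge_zero[of "g v"]]
      by (simp only: norm_mult complex_mod_cnj)
  qed auto
  then show ?thesis
    by (rule abs_summable_summable)
qed

lemma ell2_inner_add_left:
  assumes "f \<in> ell2 V" "g \<in> ell2 V" "h \<in> ell2 V"
  shows "ell2_inner V (\<lambda>v. f v + g v) h = ell2_inner V f h + ell2_inner V g h"
  using infsum_add[OF ell2_inner_summable[OF assms(1,3)] ell2_inner_summable[OF assms(2,3)]]
  by (simp add: ell2_inner_def distrib_right)

lemma ell2_inner_scale_left: "ell2_inner V (\<lambda>v. c * f v) h = c * ell2_inner V f h"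
  by (simp add: ell2_inner_def mult.assoc infsum_cmult_right')

lemma ell2_inner_commute: "ell2_inner V g f = cnj (ell2_inner V f g)"
  by (simp add: ell2_inner_def mult.commute flip: infsum_cnj)

lemma ell2_inner_diff_left:
  assumes "f \<in> ell2 V" "g \<in> ell2 V" "h \<in> ell2 V"
  shows "ell2_inner V (\<lambda>v. f v - g v) h = ell2_inner V f h - ell2_inner V g h"
  using ell2_inner_add_left[OF assms(1) ell2_scale[OF assms(2), of "-1"] assms(3)]
    ell2_inner_scale_left[of V "-1" g h] by simp

lemma ell2_inner_add_right:
  assumes "f \<in> ell2 V" "g \<in> ell2 V" "h \<in> ell2 V"
  shows "ell2_inner V h (\<lambda>v. f v + g v) = ell2_inner V h f + ell2_inner V h g"
  by (subst (1 2 3) ell2_inner_commute) (simp add: ell2_inner_add_left[OF assms])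

lemma ell2_inner_diff_right:
  assumes "f \<in> ell2 V" "g \<in> ell2 V" "h \<in> ell2 V"
  shows "ell2_inner V h (\<lambda>v. f v - g v) = ell2_inner V h f - ell2_inner V h g"
  by (subst (1 2 3) ell2_inner_commute) (simp add: ell2_inner_diff_left[OF assms])

lemma ell2_inner_scale_right: "ell2_inner V h (\<lambda>v. c * f v) = cnj c * ell2_inner V h f"
  by (subst (1 2) ell2_inner_commute) (simp add: ell2_inner_scale_left)

lemma ell2_norm_nonneg [simp]: "0 \<le> ell2_norm V f"
  by (simp add: ell2_norm_def infsum_nonneg)

lemma ell2_norm_square: "(ell2_norm V f)\<^sup>2 = (\<Sum>\<^sub>\<infinity>v\<in>V. (cmod (f v))\<^sup>2)"
  by (simp add: ell2_norm_def infsum_nonneg)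

lemma ell2_norm_zero [simp]: "ell2_norm V (\<lambda>v. 0) = 0"
  by (simp add: ell2_norm_def)

lemma ell2_inner_self:
  assumes "f \<in> ell2 V"
  shows "ell2_inner V f f = complex_of_real ((ell2_norm V f)\<^sup>2)"
  using infsumI[OF has_sum_of_real[OF has_sum_infsum[OF ell2_summable[OF assms]], where 'a=complex]]
  by (simp add: ell2_norm_square ell2_inner_def flip: complex_norm_square)

lemma ell2_norm_scale: "ell2_norm V (\<lambda>v. c * f v) = cmod c * ell2_norm V f"
  by (simp add: ell2_norm_def norm_mult power_mult_distrib infsum_cmult_right' real_sqrt_mult)

lemma ell2_norm_minus: "ell2_norm V (\<lambda>v. - f v) = ell2_norm V f"
  by (simp add: ell2_norm_def)

lemma ell2_norm_minus_commute: "ell2_norm V (\<lambda>v. f v - g v) = ell2_norm V (\<lambda>v. g v - f v)"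
  by (simp add: ell2_norm_def norm_minus_commute)

text \<open>Cauchy-Schwarz, the triangle inequality, the contraction estimate in
  \<open>bounded_below_surj\<close> and the norm estimate in
  \<open>poly_operator_norm_le_aux\<close> all start from this expansion.\<close>

lemma ell2_norm_diff_square:
  assumes "f \<in> ell2 V" "g \<in> ell2 V"
  shows "(ell2_norm V (\<lambda>v. f v - g v))\<^sup>2
    = (ell2_norm V f)\<^sup>2 + (ell2_norm V g)\<^sup>2 - 2 * Re (ell2_inner V f g)"
proof -
  have "complex_of_real ((ell2_norm V (\<lambda>v. f v - g v))\<^sup>2)
    = complex_of_real ((ell2_norm V f)\<^sup>2) + complex_of_real ((ell2_norm V g)\<^sup>2)
      - (ell2_inner V f g + cnj (ell2_inner V f g))"
    using assms
    by (subst ell2_inner_self[symmetric])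
      (simp_all add: ell2_inner_diff_left ell2_inner_diff_right ell2_inner_self
        flip: ell2_inner_commute)
  also have "\<dots> = complex_of_real ((ell2_norm V f)\<^sup>2 + (ell2_norm V g)\<^sup>2 - 2 * Re (ell2_inner V f g))"
    by (simp add: complex_add_cnj)
  finally show ?thesis
    by (simp only: of_real_eq_iff)
qed

lemma ell2_Cauchy_Schwarz:
  assumes "f \<in> ell2 V" "g \<in> ell2 V"
  shows "cmod (ell2_inner V f g) \<le> ell2_norm V f * ell2_norm V g"
proof -
  define a where "a = ell2_inner V f g"
  \<comment> \<open>Subtracting the multiple \<open>t * a\<close> of \<open>g\<close>, with
    \<open>a\<close> the inner product itself, makes the cross term real, so a real parameter
    \<open>t\<close> is enough.\<close>
  have quad: "0 \<le> (ell2_norm V f)\<^sup>2 - 2 * t * (cmod a)\<^sup>2 + t\<^sup>2 * (cmod a)\<^sup>2 * (ell2_norm V g)\<^sup>2" for t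
  proof -
    have "0 \<le> (ell2_norm V (\<lambda>v. f v - (t * a) * g v))\<^sup>2"
      by simp
    also have "\<dots> = (ell2_norm V f)\<^sup>2 + (cmod (t * a) * ell2_norm V g)\<^sup>2
        - 2 * Re (cnj (t * a) * a)"
      using assms by (subst ell2_norm_diff_square)
        (simp_all add: ell2_norm_scale ell2_inner_scale_right a_def)
    also have "Re (cnj (t * a) * a) = t * (cmod a)\<^sup>2"
      by (simp add: cmod_power2 algebra_simps) (simp add: algebra_simps power2_eq_square)
    finally show ?thesis
      by (simp add: norm_mult power_mult_distrib algebra_simps)
  qed
  show ?thesis
  proof (cases "ell2_norm V g = 0")
    case True
    have "a = 0"
    proof (rule ccontr)
      assume "a \<noteq> 0"
      \<comment> \<open>When \<open>g\<close> has norm 0 the quadratic in \<open>t\<close> is affine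
        with negative slope; this \<open>t\<close> is large enough to make it negative.\<close>
      then have "(ell2_norm V f)\<^sup>2 - 2 * (((ell2_norm V f)\<^sup>2 + 1) / (cmod a)\<^sup>2) * (cmod a)\<^sup>2 \<ge> 0"
        using quad[of "((ell2_norm V f)\<^sup>2 + 1) / (cmod a)\<^sup>2"] True by simp
      then show False
        using \<open>a \<noteq> 0\<close> zero_le_power2[of "ell2_norm V f"] by simp
    qed
    then show ?thesis
      by (simp add: a_def)
  next
    case False
    let ?n = "(ell2_norm V g)\<^sup>2"
    have n: "?n > 0"
      using False by simp
    \<comment> \<open>The minimiser of the quadratic is \<open>t = 1 / ?n\<close>.\<close>
    have "(1 / ?n)\<^sup>2 * (cmod a)\<^sup>2 * ?n = (cmod a)\<^sup>2 / ?n"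
      using n by (simp add: power2_eq_square)
    then have "(cmod a)\<^sup>2 / ?n \<le> (ell2_norm V f)\<^sup>2"
      using quad[of "1 / ?n"] by simp
    then have "(cmod a)\<^sup>2 \<le> (ell2_norm V f * ell2_norm V g)\<^sup>2"
      using n by (simp only: pos_divide_le_eq power_mult_distrib)
    then show ?thesis
      unfolding a_def[symmetric] by (rule power2_le_imp_le) simp
  qed
qed

lemma ell2_norm_diff_le:
  assumes "f \<in> ell2 V" "g \<in> ell2 V"
  shows "ell2_norm V (\<lambda>v. f v - g v) \<le> ell2_norm V f + ell2_norm V g"
proof (rule power2_le_imp_le)
  have "- Re (ell2_inner V f g) \<le> ell2_norm V f * ell2_norm V g"
    using ell2_Cauchy_Schwarz[OF assms] abs_Re_le_cmod[of "ell2_inner V f g"] by linarith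
  then show "(ell2_norm V (\<lambda>v. f v - g v))\<^sup>2 \<le> (ell2_norm V f + ell2_norm V g)\<^sup>2"
    by (simp add: ell2_norm_diff_square[OF assms] power2_sum)
qed simp

lemma ell2_norm_add_le:
  assumes "f \<in> ell2 V" "g \<in> ell2 V"
  shows "ell2_norm V (\<lambda>v. f v + g v) \<le> ell2_norm V f + ell2_norm V g"
  using ell2_norm_diff_le[OF assms(1) ell2_scale[OF assms(2), of "-1"]]
  by (simp add: ell2_norm_minus)

lemma ell2_norm_dist_triangle:
  assumes "f \<in> ell2 V" "g \<in> ell2 V" "h \<in> ell2 V"
  shows "ell2_norm V (\<lambda>v. f v - h v) \<le> ell2_norm V (\<lambda>v. f v - g v) + ell2_norm V (\<lambda>v. g v - h v)"
  using ell2_norm_add_le[OF ell2_diff[OF assms(1,2)] ell2_diff[OF assms(2,3)]] by simp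

section \<open>Completeness and approximation by finitely supported vectors\<close>

lemma ell2_inner_delta:
  assumes "v \<in> V"
  shows "ell2_inner V f (delta v) = f v"
proof -
  have "ell2_inner V f (delta v) = (\<Sum>\<^sub>\<infinity>w\<in>{v}. f w * cnj (delta v w))"
    unfolding ell2_inner_def using assms
    by (intro infsum_cong_neutral) (auto simp: delta_def)
  then show ?thesis
    by (simp add: delta_def)
qed

lemma ell2_finite_sum_le:
  assumes "f \<in> ell2 V" "finite F" "F \<subseteq> V"
  shows "(\<Sum>v\<in>F. (cmod (f v))\<^sup>2) \<le> (ell2_norm V f)\<^sup>2"
  unfolding ell2_norm_square using assms by (intro finite_sum_le_infsum) (auto simp: ell2_def)

text \<open>For nonnegative families, summability and the value of the sum are controlled by finite
  partial sums. Limits of Cauchy sequences and images under the adjacency operator are both placed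
  in \<open>ell2 V\<close> in this way.\<close>

lemma ell2_bounded_sums:
  assumes "\<And>v. v \<notin> V \<Longrightarrow> f v = 0"
    and "\<And>F. finite F \<Longrightarrow> F \<subseteq> V \<Longrightarrow> (\<Sum>v\<in>F. (cmod (f v))\<^sup>2) \<le> C\<^sup>2" and "C \<ge> 0"
  shows "f \<in> ell2 V" and "ell2_norm V f \<le> C"
proof -
  have s: "(\<lambda>v. (cmod (f v))\<^sup>2) summable_on V"
    using assms by (intro nonneg_bounded_partial_sums_imp_summable_on[where C="C\<^sup>2"])
      (auto simp: eventually_finite_subsets_at_top intro!: exI[of _ "{}"])
  then show "f \<in> ell2 V"
    using assms by (simp add: ell2_def)
  have "(ell2_norm V f)\<^sup>2 \<le> C\<^sup>2"
    unfolding ell2_norm_square using assms s by (intro infsum_le_finite_sums) auto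
  then show "ell2_norm V f \<le> C"
    using assms power2_le_imp_le by blast
qed

lemma ell2_pointwise_le:
  assumes "f \<in> ell2 V"
  shows "cmod (f v) \<le> ell2_norm V f"
proof (cases "v \<in> V")
  case True
  then have "(\<Sum>w\<in>{v}. (cmod (f w))\<^sup>2) \<le> (ell2_norm V f)\<^sup>2"
    by (intro ell2_finite_sum_le[OF assms]) simp_all
  then have "(cmod (f v))\<^sup>2 \<le> (ell2_norm V f)\<^sup>2"
    by (simp only: sum.insert finite.emptyI empty_iff sum.empty not_False_eq_True add_0_right)
  then show ?thesis
    by (rule power2_le_imp_le) (rule ell2_norm_nonneg)
next
  case False
  then show ?thesis
    using ell2_outside[OF assms False] by simp
qed

lemma ell2_norm_eq_0:
  assumes "f \<in> ell2 V" "ell2_norm V f = 0"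
  shows "f = (\<lambda>v. 0)"
  using ell2_pointwise_le[OF assms(1)] assms(2) by (intro ext) simp

text \<open>Point evaluations are bounded by the norm, so a Cauchy sequence converges pointwise.
  Over a finite set of vertices the Cauchy estimate survives the limit in one index, and the finite
  sums then control the norm.\<close>

lemma ell2_complete:
  assumes f: "\<And>n. f n \<in> ell2 V"
    and Cauchy: "\<And>e. e > 0 \<Longrightarrow> \<exists>N. \<forall>m\<ge>N. \<forall>n\<ge>N. ell2_norm V (\<lambda>v. f m v - f n v) \<le> e"
  obtains g where "g \<in> ell2 V" "(\<lambda>n. ell2_norm V (\<lambda>v. f n v - g v)) \<longlonglongrightarrow> 0"
proof -
  have "Cauchy (\<lambda>n. f n v)" for v
  proof (rule metric_CauchyI)
    fix e :: real assume "e > 0"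
    then obtain N where N: "\<forall>m\<ge>N. \<forall>n\<ge>N. ell2_norm V (\<lambda>v. f m v - f n v) \<le> e / 2"
      using Cauchy[of "e / 2"] by auto
    have "dist (f m v) (f n v) < e" if "m \<ge> N" "n \<ge> N" for m n
    proof -
      have "dist (f m v) (f n v) \<le> ell2_norm V (\<lambda>v. f m v - f n v)"
        using ell2_pointwise_le[OF ell2_diff[OF f[of m] f[of n]]] by (simp add: dist_norm)
      also have "\<dots> \<le> e / 2"
        using N that by blast
      finally show ?thesis
        using \<open>e > 0\<close> by simp
    qed
    then show "\<exists>M. \<forall>m\<ge>M. \<forall>n\<ge>M. dist (f m v) (f n v) < e"
      by blast
  qed
  then have "\<exists>l. (\<lambda>n. f n v) \<longlonglongrightarrow> l" for v
    by (simp add: Cauchy_convergent convergentD)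
  then obtain g where g: "\<And>v. (\<lambda>n. f n v) \<longlonglongrightarrow> g v"
    by metis
  have outside: "g v = 0" if "v \<notin> V" for v
    using LIMSEQ_unique[OF g[of v]] ell2_outside[OF f that] by simp
  have close: "(\<lambda>v. f n v - g v) \<in> ell2 V \<and> ell2_norm V (\<lambda>v. f n v - g v) \<le> e"
    if "e > 0" and N: "\<forall>m\<ge>N. \<forall>n\<ge>N. ell2_norm V (\<lambda>v. f m v - f n v) \<le> e" and "n \<ge> N" for e n N
  proof -
    have "(\<Sum>v\<in>F. (cmod (f n v - g v))\<^sup>2) \<le> e\<^sup>2" if "finite F" "F \<subseteq> V" for F
    proof (rule LIMSEQ_le_const2)
      show "(\<lambda>m. \<Sum>v\<in>F. (cmod (f n v - f m v))\<^sup>2) \<longlonglongrightarrow> (\<Sum>v\<in>F. (cmod (f n v - g v))\<^sup>2)"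
        by (intro tendsto_intros g)
      have "(\<Sum>v\<in>F. (cmod (f n v - f m v))\<^sup>2) \<le> e\<^sup>2" if "m \<ge> N" for m
      proof -
        have "(\<Sum>v\<in>F. (cmod (f n v - f m v))\<^sup>2) \<le> (ell2_norm V (\<lambda>v. f n v - f m v))\<^sup>2"
          using f \<open>finite F\<close> \<open>F \<subseteq> V\<close> by (intro ell2_finite_sum_le ell2_diff)
        also have "\<dots> \<le> e\<^sup>2"
          using N \<open>n \<ge> N\<close> \<open>m \<ge> N\<close> by (intro power_mono) auto
        finally show ?thesis .
      qed
      then show "\<exists>N. \<forall>m\<ge>N. (\<Sum>v\<in>F. (cmod (f n v - f m v))\<^sup>2) \<le> e\<^sup>2"
        by blast
    qed
    then show ?thesis
      using ell2_bounded_sums[of V "\<lambda>v. f n v - g v" e] outside ell2_outside[OF f] \<open>e > 0\<close> by auto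
  qed
  show ?thesis
  proof
    obtain N where "\<forall>m\<ge>N. \<forall>n\<ge>N. ell2_norm V (\<lambda>v. f m v - f n v) \<le> 1"
      using Cauchy[of 1] by auto
    then have "(\<lambda>v. f N v - g v) \<in> ell2 V"
      using close[of 1 N N] by simp
    from ell2_diff[OF f[of N] this] show "g \<in> ell2 V"
      by simp
    show "(\<lambda>n. ell2_norm V (\<lambda>v. f n v - g v)) \<longlonglongrightarrow> 0"
    proof (rule LIMSEQ_I)
      fix e :: real assume "e > 0"
      then obtain N where N: "\<forall>m\<ge>N. \<forall>n\<ge>N. ell2_norm V (\<lambda>v. f m v - f n v) \<le> e / 2"
        using Cauchy[of "e / 2"] by auto
      have "norm (ell2_norm V (\<lambda>v. f n v - g v) - 0) < e" if "n \<ge> N" for n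
        using close[OF _ N that] \<open>e > 0\<close> by simp
      then show "\<exists>N. \<forall>n\<ge>N. norm (ell2_norm V (\<lambda>v. f n v - g v) - 0) < e"
        by blast
    qed
  qed
qed

text \<open>Truncating to \<open>F\<close> leaves the tail of the sum as squared error, hence the
  accuracy \<open>e\<^sup>2\<close> requested from the summable family.\<close>

lemma ell2_finite_approximation:
  assumes f: "f \<in> ell2 V" and e: "e > 0"
  obtains F where "finite F" "F \<subseteq> V" "ell2_norm V (\<lambda>v. f v - (\<Sum>w\<in>F. f w * delta w v)) \<le> e"
proof -
  have "e\<^sup>2 > 0"
    using e by simp
  obtain F where F: "finite F" "F \<subseteq> V"
    "dist (sum (\<lambda>v. (cmod (f v))\<^sup>2) F) (\<Sum>\<^sub>\<infinity>v\<in>V. (cmod (f v))\<^sup>2) \<le> e\<^sup>2"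
    using infsum_finite_approximation[OF ell2_summable[OF f] \<open>e\<^sup>2 > 0\<close>] by metis
  have eq: "(\<Sum>w\<in>F. f w * delta w v) = (if v \<in> F then f v else 0)" for v
    using F(1) by (simp add: delta_def if_distrib sum.delta cong: if_cong)
  have "(ell2_norm V (\<lambda>v. f v - (\<Sum>w\<in>F. f w * delta w v)))\<^sup>2 = (\<Sum>\<^sub>\<infinity>v\<in>V - F. (cmod (f v))\<^sup>2)"
    unfolding ell2_norm_square eq by (rule infsum_cong_neutral) auto
  also have "\<dots> = (\<Sum>\<^sub>\<infinity>v\<in>V. (cmod (f v))\<^sup>2) - (\<Sum>v\<in>F. (cmod (f v))\<^sup>2)"
    using infsum_Diff[OF ell2_summable[OF f] _ F(2)] F(1) by simp
  also have "\<dots> \<le> e\<^sup>2"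
    using F(3) by (simp add: dist_real_def)
  finally have "ell2_norm V (\<lambda>v. f v - (\<Sum>w\<in>F. f w * delta w v)) \<le> e"
    using less_imp_le[OF e] by (rule power2_le_imp_le)
  with F(1,2) show ?thesis
    by (rule that)
qed

section \<open>Bounded operators\<close>

lemma bounded_operator_closed: "bounded_operator V T \<Longrightarrow> f \<in> ell2 V \<Longrightarrow> T f \<in> ell2 V"
  by (simp add: bounded_operator_def)

lemma bounded_operator_add:
  "bounded_operator V T \<Longrightarrow> f \<in> ell2 V \<Longrightarrow> g \<in> ell2 V \<Longrightarrow> T (\<lambda>v. f v + g v) = (\<lambda>v. T f v + T g v)"
  by (simp add: bounded_operator_def)

lemma bounded_operator_scale:
  "bounded_operator V T \<Longrightarrow> f \<in> ell2 V \<Longrightarrow> T (\<lambda>v. c * f v) = (\<lambda>v. c * T f v)"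
  by (simp add: bounded_operator_def)

lemma bounded_operator_diff:
  assumes "bounded_operator V T" "f \<in> ell2 V" "g \<in> ell2 V"
  shows "T (\<lambda>v. f v - g v) = (\<lambda>v. T f v - T g v)"
  using bounded_operator_add[OF assms(1,2) ell2_scale[OF assms(3), of "-1"]]
    bounded_operator_scale[OF assms(1,3), of "-1"] by simp

text \<open>The constant in the definition may be zero or, on a trivial space, negative;
  \<open>\<bar>C\<bar> + 1\<close> is one that can be divided by.\<close>

lemma bounded_operator_bound:
  assumes "bounded_operator V T"
  obtains C where "C > 0" "\<And>f. f \<in> ell2 V \<Longrightarrow> ell2_norm V (T f) \<le> C * ell2_norm V f"
proof -
  obtain C where C: "\<forall>f\<in>ell2 V. ell2_norm V (T f) \<le> C * ell2_norm V f"
    using assms by (auto simp: bounded_operator_def)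
  have "ell2_norm V (T f) \<le> (\<bar>C\<bar> + 1) * ell2_norm V f" if "f \<in> ell2 V" for f
  proof -
    have "C * ell2_norm V f \<le> (\<bar>C\<bar> + 1) * ell2_norm V f"
      by (intro mult_right_mono) auto
    then show ?thesis
      using C that by force
  qed
  then show ?thesis
    using that[of "\<bar>C\<bar> + 1"] by auto
qed

lemma bounded_operator_difference:
  assumes S: "bounded_operator V S" and T: "bounded_operator V T"
  shows "bounded_operator V (\<lambda>f v. S f v - T f v)"
proof -
  obtain C D where C: "\<And>f. f \<in> ell2 V \<Longrightarrow> ell2_norm V (S f) \<le> C * ell2_norm V f"
    and D: "\<And>f. f \<in> ell2 V \<Longrightarrow> ell2_norm V (T f) \<le> D * ell2_norm V f"
    by (metis bounded_operator_bound S T)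
  have "ell2_norm V (\<lambda>v. S f v - T f v) \<le> (C + D) * ell2_norm V f" if "f \<in> ell2 V" for f
    using ell2_norm_diff_le[OF bounded_operator_closed[OF S that] bounded_operator_closed[OF T that]]
      C[OF that] D[OF that] by (simp add: distrib_right)
  then show ?thesis
    unfolding bounded_operator_def
    by (intro conjI exI[of _ "C + D"]) (auto simp: bounded_operator_closed[OF S] bounded_operator_closed[OF T]
        bounded_operator_add[OF S] bounded_operator_add[OF T]
        bounded_operator_scale[OF S] bounded_operator_scale[OF T] right_diff_distrib)
qed

text \<open>A real \<open>SUP\<close> is informative only for sets bounded above, so every estimate
  from above by \<open>operator_norm\<close> passes through this fact.\<close>

lemma bdd_above_operator_norm:
  assumes "bounded_operator V T"
  shows "bdd_above ((\<lambda>f. ell2_norm V (T f)) ` {f \<in> ell2 V. ell2_norm V f \<le> 1})"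
proof -
  obtain C where C: "C > 0" "\<And>f. f \<in> ell2 V \<Longrightarrow> ell2_norm V (T f) \<le> C * ell2_norm V f"
    using bounded_operator_bound[OF assms(1)] by metis
  show ?thesis
  proof (rule bdd_aboveI2)
    fix h assume h: "h \<in> {f \<in> ell2 V. ell2_norm V f \<le> 1}"
    then have "C * ell2_norm V h \<le> C * 1"
      using C(1) by (intro mult_left_mono) auto
    then show "ell2_norm V (T h) \<le> C"
      using C(2)[of h] h by simp
  qed
qed

lemma operator_norm_upper:
  assumes "bounded_operator V T" "f \<in> ell2 V"
  shows "ell2_norm V (T f) \<le> operator_norm V T * ell2_norm V f"
proof (cases "ell2_norm V f = 0")
  case True
  then show ?thesis
    using bounded_operator_bound[OF assms(1)] assms(2) by (metis mult_zero_right)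
next
  case False
  define n where "n = ell2_norm V f"
  have n: "n > 0"
    using False ell2_norm_nonneg[of V f] by (simp add: n_def less_le)
  define g where "g = (\<lambda>v. complex_of_real (1 / n) * f v)"
  have g: "g \<in> {f \<in> ell2 V. ell2_norm V f \<le> 1}"
    using ell2_scale[OF assms(2), of "complex_of_real (1 / n)"] ell2_norm_scale[of V "complex_of_real (1 / n)" f] n
    by (simp add: g_def norm_divide flip: n_def)
  have "ell2_norm V (T g) \<le> operator_norm V T"
    unfolding operator_norm_def using g bdd_above_operator_norm[OF assms(1)] by (rule cSUP_upper)
  moreover have "ell2_norm V (T g) = ell2_norm V (T f) / n"
    using n ell2_norm_scale[of V "complex_of_real (1 / n)" "T f"]
    unfolding g_def bounded_operator_scale[OF assms] by (simp add: norm_divide)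
  ultimately show ?thesis
    using n by (simp add: n_def pos_divide_le_eq)
qed

lemma operator_norm_le:
  assumes "\<And>f. f \<in> ell2 V \<Longrightarrow> ell2_norm V (T f) \<le> C * ell2_norm V f" "C \<ge> 0"
  shows "operator_norm V T \<le> C"
  unfolding operator_norm_def
proof (rule cSUP_least)
  have "(\<lambda>v. 0) \<in> {f \<in> ell2 V. ell2_norm V f \<le> 1}"
    by simp
  then show "{f \<in> ell2 V. ell2_norm V f \<le> 1} \<noteq> {}"
    by blast
  fix f assume f: "f \<in> {f \<in> ell2 V. ell2_norm V f \<le> 1}"
  then have "C * ell2_norm V f \<le> C * 1"
    using assms(2) by (intro mult_left_mono) auto
  then show "ell2_norm V (T f) \<le> C"
    using assms(1)[of f] f by simp
qed

lemma operator_norm_nonneg: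
  assumes "bounded_operator V T"
  shows "0 \<le> operator_norm V T"
proof -
  have z: "(\<lambda>v. 0) \<in> {f \<in> ell2 V. ell2_norm V f \<le> 1}"
    by simp
  have "ell2_norm V (T (\<lambda>v. 0)) \<le> operator_norm V T"
    unfolding operator_norm_def using z bdd_above_operator_norm[OF assms] by (rule cSUP_upper)
  then show ?thesis
    using ell2_norm_nonneg order_trans by blast
qed

section \<open>Polynomials in a self-adjoint operator\<close>

lemma poly_operator_eq:
  assumes "degree p \<le> n"
  shows "poly_operator p T f = (\<lambda>v. \<Sum>i\<le>n. coeff p i * (T ^^ i) f v)"
  unfolding poly_operator_def
  by (intro ext sum.mono_neutral_left) (use assms in \<open>auto simp: coeff_eq_0\<close>)

lemma poly_operator_0 [simp]: "poly_operator 0 T f = (\<lambda>v. 0)"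
  by (simp add: poly_operator_def)

lemma poly_operator_const [simp]: "poly_operator [:c:] T f = (\<lambda>v. c * f v)"
  by (simp add: poly_operator_def)

lemma poly_operator_1 [simp]: "poly_operator 1 T f = f"
  by (simp add: poly_operator_def)

lemma poly_operator_add:
  "poly_operator (p + q) T f = (\<lambda>v. poly_operator p T f v + poly_operator q T f v)"
proof -
  let ?n = "max (degree p) (degree q)"
  show ?thesis
    using poly_operator_eq[OF degree_add_le[of p ?n q], of T f]
      poly_operator_eq[of p ?n T f] poly_operator_eq[of q ?n T f]
    by (simp add: distrib_right sum.distrib)
qed

lemma poly_operator_smult: "poly_operator (smult c p) T f = (\<lambda>v. c * poly_operator p T f v)"
  by (subst poly_operator_eq[OF degree_smult_le])
    (simp add: poly_operator_def sum_distrib_left mult.assoc)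

lemma poly_operator_diff:
  "poly_operator (p - q) T f = (\<lambda>v. poly_operator p T f v - poly_operator q T f v)"
  using poly_operator_add[of p "smult (-1) q" T f] poly_operator_smult[of "-1" q T f] by simp

text \<open>Horner's scheme with the extra \<open>T\<close> acting on the vector first; inductions
  over \<open>p\<close> therefore generalise over the vector.\<close>

lemma poly_operator_pCons:
  "poly_operator (pCons a p) T f = (\<lambda>v. a * f v + poly_operator p T (T f) v)"
  by (subst poly_operator_eq[OF degree_pCons_le])
    (simp add: poly_operator_def sum.atMost_Suc_shift funpow_swap1 del: sum.atMost_Suc)

lemma poly_operator_linear: "poly_operator [:- z, 1:] T f = (\<lambda>v. T f v - z * f v)"
  by (simp add: poly_operator_pCons)

text \<open>Symmetry is demanded on \<open>ell2 V\<close> only: operators are total functions whose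
  values elsewhere are arbitrary.\<close>

locale self_adjoint_operator =
  fixes V :: "'a set" and T :: "'a operator"
  assumes bounded: "bounded_operator V T"
    and self_adjoint: "f \<in> ell2 V \<Longrightarrow> g \<in> ell2 V \<Longrightarrow> ell2_inner V (T f) g = ell2_inner V f (T g)"
begin

lemma closed [simp]: "f \<in> ell2 V \<Longrightarrow> T f \<in> ell2 V"
  using bounded by (rule bounded_operator_closed)

lemma poly_closed [simp]: "f \<in> ell2 V \<Longrightarrow> poly_operator p T f \<in> ell2 V"
  by (induction p arbitrary: f) (simp_all add: poly_operator_pCons)

lemma poly_operator_vector_add:
  "f \<in> ell2 V \<Longrightarrow> g \<in> ell2 V \<Longrightarrow>
    poly_operator p T (\<lambda>v. f v + g v) = (\<lambda>v. poly_operator p T f v + poly_operator p T g v)"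
  by (induction p arbitrary: f g)
    (simp_all add: poly_operator_pCons bounded_operator_add[OF bounded] algebra_simps)

lemma poly_operator_vector_scale:
  "f \<in> ell2 V \<Longrightarrow> poly_operator p T (\<lambda>v. c * f v) = (\<lambda>v. c * poly_operator p T f v)"
  by (induction p arbitrary: f)
    (simp_all add: poly_operator_pCons bounded_operator_scale[OF bounded] algebra_simps)

lemma poly_operator_commute:
  assumes "f \<in> ell2 V"
  shows "T (poly_operator p T f) = poly_operator p T (T f)"
  using assms
proof (induction p arbitrary: f)
  case 0
  then show ?case
    using bounded_operator_scale[OF bounded, of "\<lambda>v. 0" 0] by simp
next
  case (pCons a p)
  then show ?case
    by (simp add: poly_operator_pCons bounded_operator_add[OF bounded] bounded_operator_scale[OF bounded])
qed

lemma poly_operator_mult: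
  "f \<in> ell2 V \<Longrightarrow> poly_operator (p * q) T f = poly_operator p T (poly_operator q T f)"
proof (induction p arbitrary: f)
  case (pCons a p)
  then show ?case
    by (simp add: poly_operator_pCons poly_operator_add poly_operator_smult poly_operator_commute)
qed simp

text \<open>Conjugating the coefficients gives the adjoint. Polynomials in \<open>T\<close> commute,
  so each of them is a normal operator.\<close>

lemma poly_operator_adjoint:
  "f \<in> ell2 V \<Longrightarrow> g \<in> ell2 V \<Longrightarrow>
    ell2_inner V (poly_operator p T f) g = ell2_inner V f (poly_operator (map_poly cnj p) T g)"
proof (induction p arbitrary: f g)
  case 0
  then show ?case
    using ell2_inner_scale_left[of V 0 "\<lambda>v. 0" g] ell2_inner_scale_right[of V f 0 "\<lambda>v. 0"] by simp
next
  case (pCons a p)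
  have m: "map_poly cnj (pCons a p) = pCons (cnj a) (map_poly cnj p)"
    using pCons.hyps by (intro map_poly_pCons) simp
  have "ell2_inner V (poly_operator (pCons a p) T f) g
    = a * ell2_inner V f g + ell2_inner V (T f) (poly_operator (map_poly cnj p) T g)"
    using pCons by (simp add: poly_operator_pCons ell2_inner_add_left ell2_inner_scale_left)
  also have "\<dots> = a * ell2_inner V f g + ell2_inner V f (poly_operator (map_poly cnj p) T (T g))"
    using pCons.prems by (simp add: self_adjoint poly_operator_commute)
  also have "\<dots> = ell2_inner V f (poly_operator (map_poly cnj (pCons a p)) T g)"
    using pCons.prems unfolding m
    by (simp add: poly_operator_pCons ell2_inner_add_right ell2_inner_scale_right)
  finally show ?case .
qed

lemma poly_operator_bound:
  "\<exists>C\<ge>0. \<forall>f\<in>ell2 V. ell2_norm V (poly_operator p T f) \<le> C * ell2_norm V f"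
proof (induction p)
  case 0
  then show ?case
    by auto
next
  case (pCons a p)
  then obtain C where C: "C \<ge> 0" "\<And>f. f \<in> ell2 V \<Longrightarrow> ell2_norm V (poly_operator p T f) \<le> C * ell2_norm V f"
    by blast
  obtain D where D: "D > 0" "\<And>f. f \<in> ell2 V \<Longrightarrow> ell2_norm V (T f) \<le> D * ell2_norm V f"
    using bounded_operator_bound[OF bounded] by metis
  have "ell2_norm V (poly_operator (pCons a p) T f) \<le> (cmod a + C * D) * ell2_norm V f"
    if f: "f \<in> ell2 V" for f
  proof -
    have "ell2_norm V (poly_operator (pCons a p) T f) \<le> cmod a * ell2_norm V f + C * ell2_norm V (T f)"
      using ell2_norm_add_le[OF ell2_scale[OF f, of a] poly_closed[OF closed[OF f], of p]]
        C(2)[of "T f"] f by (simp add: poly_operator_pCons ell2_norm_scale)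
    also have "\<dots> \<le> cmod a * ell2_norm V f + C * (D * ell2_norm V f)"
      using C(1) D(2)[OF f] by (intro add_left_mono mult_left_mono)
    finally show ?thesis
      by (simp add: algebra_simps)
  qed
  moreover have "cmod a + C * D \<ge> 0"
    using C D by simp
  ultimately show ?case
    by blast
qed

lemma bounded_poly_operator: "bounded_operator V (poly_operator p T)"
  unfolding bounded_operator_def
  using poly_operator_bound[of p] by (auto simp: poly_operator_vector_add poly_operator_vector_scale)

text \<open>Normality: the squared norm of \<open>S\<^sup>* f\<close> is the inner product of
  \<open>f\<close> with \<open>S S\<^sup>* f = S\<^sup>* S f\<close>, hence the squared norm of
  \<open>S f\<close>.\<close>

lemma poly_operator_norm_cnj:
  assumes f: "f \<in> ell2 V"
  shows "ell2_norm V (poly_operator (map_poly cnj p) T f) = ell2_norm V (poly_operator p T f)"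
proof -
  let ?p = "poly_operator p T" and ?q = "poly_operator (map_poly cnj p) T"
  have "map_poly cnj (map_poly cnj p) = p"
    by (simp add: map_poly_map_poly o_def)
  then have "ell2_inner V (?q f) (?q f) = ell2_inner V f (?p (?q f))"
    using poly_operator_adjoint[of f "?q f" "map_poly cnj p"] f by simp
  also have "?p (?q f) = ?q (?p f)"
    using f by (simp flip: poly_operator_mult add: mult.commute)
  also have "ell2_inner V f (?q (?p f)) = ell2_inner V (?p f) (?p f)"
    using f by (simp add: poly_operator_adjoint)
  finally have "(ell2_norm V (?q f))\<^sup>2 = (ell2_norm V (?p f))\<^sup>2"
    using f by (simp add: ell2_inner_self flip: of_real_power)
  then show ?thesis
    by (simp add: power2_eq_iff_nonneg)
qed

end

section \<open>The spectrum of a self-adjoint operator\<close>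

context self_adjoint_operator
begin

text \<open>Off the spectrum there is a bounded left inverse; the reciprocal of its bound is the
  lower bound. The converse is \<open>not_in_spectrumI\<close>.\<close>

lemma spectrum_bounded_below:
  assumes "z \<notin> spectrum V T"
  shows "\<exists>c>0. \<forall>f\<in>ell2 V. c * ell2_norm V f \<le> ell2_norm V (poly_operator [:- z, 1:] T f)"
proof -
  obtain R where R: "bounded_operator V R" "\<And>f. f \<in> ell2 V \<Longrightarrow> R (\<lambda>v. T f v - z * f v) = f"
    using assms by (auto simp: spectrum_def)
  obtain C where C: "C > 0" "\<And>f. f \<in> ell2 V \<Longrightarrow> ell2_norm V (R f) \<le> C * ell2_norm V f"
    using bounded_operator_bound[OF R(1)] by metis
  have "(1 / C) * ell2_norm V f \<le> ell2_norm V (poly_operator [:- z, 1:] T f)" if "f \<in> ell2 V" for f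
    using C(2)[of "\<lambda>v. T f v - z * f v"] R(2)[OF that] that C(1)
    by (simp add: poly_operator_linear pos_divide_le_eq mult.commute)
  then show ?thesis
    using C(1) by (intro exI[of _ "1 / C"]) auto
qed

text \<open>The equation \<open>S\<^sup>*S f = g\<close> for \<open>S = p(T)\<close> bounded below is solved by the iteration
  \<open>f \<mapsto> f + (g - S\<^sup>*S f) / C\<^sup>2\<close>: the residual \<open>g - S\<^sup>*S f\<close> is mapped by \<open>I - S\<^sup>*S / C\<^sup>2\<close>, which
  is a contraction when \<open>C\<close> is a bound for \<open>S\<close>.\<close>

lemma bounded_below_surj:
  assumes c: "c > 0" "\<And>f. f \<in> ell2 V \<Longrightarrow> c * ell2_norm V f \<le> ell2_norm V (poly_operator p T f)"
    and g: "g \<in> ell2 V"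
  shows "\<exists>f\<in>ell2 V. poly_operator p T f = g"
proof -
  define S where "S = poly_operator p T"
  define S' where "S' = poly_operator (map_poly cnj p) T"
  have S[simp]: "S f \<in> ell2 V" "S' f \<in> ell2 V" if "f \<in> ell2 V" for f
    using that by (simp_all add: S_def S'_def)
  have norm_S': "ell2_norm V (S' f) = ell2_norm V (S f)" if "f \<in> ell2 V" for f
    using that by (simp add: S_def S'_def poly_operator_norm_cnj)
  have commute: "S (S' f) = S' (S f)" if "f \<in> ell2 V" for f
    using that by (simp add: S_def S'_def mult.commute flip: poly_operator_mult)
  \<comment> \<open>By normality the order of the factors is immaterial; with \<open>S\<close>
    outermost, a solution \<open>x\<close> of \<open>B x = g\<close> yields the preimage
    \<open>S' x\<close> of \<open>g\<close> at once.\<close>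
  define B where "B = (\<lambda>f. S (S' f))"
  have B_op: "bounded_operator V B"
  proof -
    have "bounded_operator V (poly_operator (p * map_poly cnj p) T)"
      by (rule bounded_poly_operator)
    moreover have "poly_operator (p * map_poly cnj p) T f = B f" if "f \<in> ell2 V" for f
      using that by (simp add: poly_operator_mult B_def S_def S'_def)
    ultimately show ?thesis
      unfolding bounded_operator_def by simp
  qed
  have B[simp]: "B f \<in> ell2 V" if "f \<in> ell2 V" for f
    using that by (simp add: B_def)
  obtain D where D: "D > 0" "\<And>f. f \<in> ell2 V \<Longrightarrow> ell2_norm V (S f) \<le> D * ell2_norm V f"
    unfolding S_def using bounded_operator_bound[OF bounded_poly_operator[of p]] by metis
  \<comment> \<open>Taking the maximum with \<open>c\<close> ensures \<open>c \<le> C\<close>, so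
    that the square root defining \<open>q\<close> is taken of a nonnegative number.\<close>
  define C where "C = max c D"
  have "C > 0" "c \<le> C"
    using c D by (auto simp: C_def)
  have C: "ell2_norm V (S f) \<le> C * ell2_norm V f" if "f \<in> ell2 V" for f
  proof -
    have "D * ell2_norm V f \<le> C * ell2_norm V f"
      by (intro mult_right_mono) (auto simp: C_def)
    then show ?thesis
      using D(2)[OF that] by linarith
  qed
  define K where "K = (\<lambda>f v. f v - complex_of_real (1 / C\<^sup>2) * B f v)"
  have K[simp]: "K f \<in> ell2 V" if "f \<in> ell2 V" for f
    unfolding K_def using that by (intro ell2_diff ell2_scale B)
  \<comment> \<open>The contraction factor of \<open>K\<close>: the squared norm of
    \<open>K f\<close> is at most that of \<open>f\<close> minus that of \<open>S f\<close> divided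
    by \<open>C\<^sup>2\<close>, and \<open>S\<close> is bounded below by \<open>c\<close>.\<close>
  define q where "q = sqrt (1 - c\<^sup>2 / C\<^sup>2)"
  have q2: "1 - c\<^sup>2 / C\<^sup>2 \<ge> 0"
    using power_mono[OF \<open>c \<le> C\<close>, of 2] \<open>C > 0\<close> c(1) by simp
  have q: "0 \<le> q" "q < 1"
    using q2 c(1) \<open>C > 0\<close> by (auto simp: q_def)
  have contraction: "ell2_norm V (K f) \<le> q * ell2_norm V f" if f: "f \<in> ell2 V" for f
  proof (rule power2_le_imp_le)
    have "ell2_inner V f (B f) = cnj (ell2_inner V (S (S' f)) f)"
      by (subst ell2_inner_commute) (simp add: B_def)
    also have "ell2_inner V (S (S' f)) f = ell2_inner V (S' f) (S' f)"
      using f by (simp add: S_def S'_def poly_operator_adjoint)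
    also have "\<dots> = complex_of_real ((ell2_norm V (S f))\<^sup>2)"
      using f by (simp add: ell2_inner_self norm_S')
    finally have inner: "ell2_inner V f (B f) = complex_of_real ((ell2_norm V (S f))\<^sup>2)"
      by simp
    have "ell2_norm V (B f) \<le> C * ell2_norm V (S f)"
      using C[of "S' f"] f by (simp add: B_def norm_S')
    then have Bf: "(ell2_norm V (B f))\<^sup>2 \<le> C\<^sup>2 * (ell2_norm V (S f))\<^sup>2"
      using power_mono[of "ell2_norm V (B f)" _ 2] by (simp flip: power_mult_distrib)
    have "(ell2_norm V (K f))\<^sup>2
      = (ell2_norm V f)\<^sup>2 + (ell2_norm V (B f))\<^sup>2 / (C\<^sup>2)\<^sup>2 - 2 * (ell2_norm V (S f))\<^sup>2 / C\<^sup>2"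
      unfolding K_def using f \<open>C > 0\<close> inner
      by (subst ell2_norm_diff_square)
        (simp_all add: ell2_norm_scale ell2_inner_scale_right norm_divide norm_power
          power_mult_distrib power_divide del: of_real_divide)
    also have "(ell2_norm V (B f))\<^sup>2 / (C\<^sup>2)\<^sup>2 \<le> (C\<^sup>2 * (ell2_norm V (S f))\<^sup>2) / (C\<^sup>2)\<^sup>2"
      using Bf by (intro divide_right_mono) auto
    also have "\<dots> = (ell2_norm V (S f))\<^sup>2 / C\<^sup>2"
      using \<open>C > 0\<close> by (simp add: power2_eq_square)
    finally have 1: "(ell2_norm V (K f))\<^sup>2 \<le> (ell2_norm V f)\<^sup>2 - (ell2_norm V (S f))\<^sup>2 / C\<^sup>2"
      by simp
    have "(c * ell2_norm V f)\<^sup>2 \<le> (ell2_norm V (S f))\<^sup>2"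
      using c(2)[OF f] c(1) by (intro power_mono) (auto simp: S_def)
    then have "(c * ell2_norm V f)\<^sup>2 / C\<^sup>2 \<le> (ell2_norm V (S f))\<^sup>2 / C\<^sup>2"
      by (intro divide_right_mono) auto
    with 1 have "(ell2_norm V (K f))\<^sup>2 \<le> (1 - c\<^sup>2 / C\<^sup>2) * (ell2_norm V f)\<^sup>2"
      by (simp add: algebra_simps power_mult_distrib)
    then show "(ell2_norm V (K f))\<^sup>2 \<le> (q * ell2_norm V f)\<^sup>2"
      using q2 by (simp add: q_def power_mult_distrib)
  qed (use q in simp)
  define f where "f = rec_nat (\<lambda>v. 0) (\<lambda>_ f v. f v + complex_of_real (1 / C\<^sup>2) * (g v - B f v))"
  have f_Suc: "f (Suc n) = (\<lambda>v. f n v + complex_of_real (1 / C\<^sup>2) * (g v - B (f n) v))" for n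
    by (simp add: f_def)
  have f_ell2[simp]: "f n \<in> ell2 V" for n
  proof (induction n)
    case (Suc n)
    then show ?case
      unfolding f_Suc using g by (intro ell2_add ell2_scale ell2_diff B)
  qed (simp add: f_def)
  define r where "r = (\<lambda>n v. g v - B (f n) v)"
  have r_ell2[simp]: "r n \<in> ell2 V" for n
    using g by (simp add: r_def)
  have r_Suc: "r (Suc n) = K (r n)" for n
  proof -
    have "f (Suc n) = (\<lambda>v. f n v + complex_of_real (1 / C\<^sup>2) * r n v)"
      unfolding f_Suc r_def ..
    then have "B (f (Suc n)) = (\<lambda>v. B (f n) v + complex_of_real (1 / C\<^sup>2) * B (r n) v)"
      by (simp add: bounded_operator_add[OF B_op] bounded_operator_scale[OF B_op] del: of_real_divide)
    then show ?thesis
      by (simp add: r_def K_def algebra_simps)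
  qed
  have r_bound: "ell2_norm V (r n) \<le> q ^ n * ell2_norm V (r 0)" for n
  proof (induction n)
    case (Suc n)
    have "ell2_norm V (r (Suc n)) \<le> q * ell2_norm V (r n)"
      unfolding r_Suc by (rule contraction) simp
    also have "\<dots> \<le> q * (q ^ n * ell2_norm V (r 0))"
      using Suc q by (intro mult_left_mono) auto
    finally show ?case
      by (simp add: mult.assoc)
  qed simp
  have r_lim: "(\<lambda>n. ell2_norm V (r n)) \<longlonglongrightarrow> 0"
  proof (rule tendsto_sandwich[OF _ _ tendsto_const])
    show "(\<lambda>n. q ^ n * ell2_norm V (r 0)) \<longlonglongrightarrow> 0"
      using tendsto_mult_right[OF LIMSEQ_power_zero[of q]] q by simp
  qed (auto intro!: always_eventually r_bound)
  \<comment> \<open>Differences of iterates satisfy \<open>B (f m - f n) = r n - r m\<close>. A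
    lower bound for \<open>B\<close> thus turns small residuals into a Cauchy sequence of
    iterates.\<close>
  have below: "c\<^sup>2 * ell2_norm V h \<le> ell2_norm V (B h)" if h: "h \<in> ell2 V" for h
  proof -
    have "c * (c * ell2_norm V h) \<le> c * ell2_norm V (S' h)"
      using c h by (intro mult_left_mono) (auto simp: norm_S' S_def)
    also have "\<dots> \<le> ell2_norm V (B h)"
      using c(2)[of "S' h"] h by (simp add: B_def S_def)
    finally show ?thesis
      by (simp add: power2_eq_square mult.assoc)
  qed
  obtain x where x: "x \<in> ell2 V" "(\<lambda>n. ell2_norm V (\<lambda>v. f n v - x v)) \<longlonglongrightarrow> 0"
  proof (rule ell2_complete[of f V])
    fix e :: real assume "e > 0"
    then have "c\<^sup>2 * e / 2 > 0"
      using c by simp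
    from order_tendstoD(2)[OF r_lim this]
    obtain N where N: "\<And>n. n \<ge> N \<Longrightarrow> ell2_norm V (r n) < c\<^sup>2 * e / 2"
      unfolding eventually_sequentially by metis
    have "ell2_norm V (\<lambda>v. f m v - f n v) \<le> e" if "m \<ge> N" "n \<ge> N" for m n
    proof -
      have "c\<^sup>2 * ell2_norm V (\<lambda>v. f m v - f n v) \<le> ell2_norm V (B (\<lambda>v. f m v - f n v))"
        by (rule below) simp
      also have "B (\<lambda>v. f m v - f n v) = (\<lambda>v. r n v - r m v)"
        by (subst bounded_operator_diff[OF B_op]) (simp_all add: r_def)
      also have "ell2_norm V (\<lambda>v. r n v - r m v) \<le> ell2_norm V (r n) + ell2_norm V (r m)"
        by (rule ell2_norm_diff_le) simp_all
      also have "\<dots> \<le> c\<^sup>2 * e"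
        using N[OF that(1)] N[OF that(2)] by simp
      finally show ?thesis
        using c by simp
    qed
    then show "\<exists>N. \<forall>m\<ge>N. \<forall>n\<ge>N. ell2_norm V (\<lambda>v. f m v - f n v) \<le> e"
      by blast
  qed simp_all
  obtain M where M: "M > 0" "\<And>h. h \<in> ell2 V \<Longrightarrow> ell2_norm V (B h) \<le> M * ell2_norm V h"
    using bounded_operator_bound[OF B_op] by metis
  \<comment> \<open>For every \<open>n\<close> the defect \<open>g - B x\<close> splits as
    \<open>r n + B (f n - x)\<close>, and both parts tend to 0.\<close>
  have "ell2_norm V (\<lambda>v. g v - B x v) \<le> 0"
  proof (rule LIMSEQ_le_const)
    show "(\<lambda>n. ell2_norm V (r n) + M * ell2_norm V (\<lambda>v. f n v - x v)) \<longlonglongrightarrow> 0"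
      using tendsto_add[OF r_lim tendsto_mult_left[OF x(2), of M]] by simp
    have "ell2_norm V (\<lambda>v. g v - B x v) \<le> ell2_norm V (r n) + M * ell2_norm V (\<lambda>v. f n v - x v)" for n
    proof -
      have eq: "(\<lambda>v. g v - B x v) = (\<lambda>v. r n v + B (\<lambda>v. f n v - x v) v)"
        by (subst bounded_operator_diff[OF B_op]) (simp_all add: r_def x)
      have "ell2_norm V (\<lambda>v. g v - B x v)
          \<le> ell2_norm V (r n) + ell2_norm V (B (\<lambda>v. f n v - x v))"
        unfolding eq using x(1) by (intro ell2_norm_add_le) simp_all
      also have "\<dots> \<le> ell2_norm V (r n) + M * ell2_norm V (\<lambda>v. f n v - x v)"
        using x(1) by (intro add_left_mono M) simp
      finally show ?thesis .
    qed
    then show "\<exists>N. \<forall>n\<ge>N. ell2_norm V (\<lambda>v. g v - B x v)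
        \<le> ell2_norm V (r n) + M * ell2_norm V (\<lambda>v. f n v - x v)"
      by blast
  qed
  then have "(\<lambda>v. g v - B x v) = (\<lambda>v. 0)"
    using g x(1) by (intro ell2_norm_eq_0[of _ V]) (auto intro: antisym)
  then have "poly_operator p T (S' x) = g"
    by (simp add: fun_eq_iff B_def S_def)
  then show ?thesis
    using x(1) S(2) by blast
qed

text \<open>\<open>T - z\<close> is a polynomial in \<open>T\<close>, so the lower bound gives
  surjectivity through \<open>bounded_below_surj\<close> as well as injectivity, and bounds the
  inverse by \<open>1 / c\<close>.\<close>

lemma not_in_spectrumI:
  assumes c: "c > 0" "\<And>f. f \<in> ell2 V \<Longrightarrow> c * ell2_norm V f \<le> ell2_norm V (\<lambda>v. T f v - z * f v)"
  shows "z \<notin> spectrum V T"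
proof -
  let ?S = "poly_operator [:- z, 1:] T"
  note S = bounded_poly_operator[of "[:- z, 1:]"]
  have below: "c * ell2_norm V f \<le> ell2_norm V (?S f)" if "f \<in> ell2 V" for f
    using c(2)[OF that] by (simp add: poly_operator_linear)
  have inj: "f = g" if "f \<in> ell2 V" "g \<in> ell2 V" "?S f = ?S g" for f g
  proof -
    have "c * ell2_norm V (\<lambda>v. f v - g v) \<le> ell2_norm V (?S (\<lambda>v. f v - g v))"
      using that by (intro below) simp
    also have "\<dots> = 0"
      using that by (simp add: bounded_operator_diff[OF S])
    finally have "ell2_norm V (\<lambda>v. f v - g v) = 0"
      using c(1) by (simp add: mult_le_0_iff antisym)
    then have "(\<lambda>v. f v - g v) = (\<lambda>v. 0)"
      using that by (intro ell2_norm_eq_0) simp_all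
    then show ?thesis
      by (simp add: fun_eq_iff)
  qed
  define R where "R = (\<lambda>g. SOME f. f \<in> ell2 V \<and> ?S f = g)"
  have R: "R g \<in> ell2 V \<and> ?S (R g) = g" if "g \<in> ell2 V" for g
    unfolding R_def using bounded_below_surj[OF c(1) below that] by (rule someI2_bex) simp
  have R_eq: "R g = f" if "g \<in> ell2 V" "f \<in> ell2 V" "?S f = g" for f g
    using inj[of "R g" f] R[OF that(1)] that by simp
  have "bounded_operator V R"
    unfolding bounded_operator_def
  proof (intro conjI ballI allI exI)
    fix f g assume "f \<in> ell2 V" "g \<in> ell2 V"
    then show "R (\<lambda>v. f v + g v) = (\<lambda>v. R f v + R g v)"
      using R by (intro R_eq) (simp_all add: bounded_operator_add[OF S])
  next
    fix a f assume "f \<in> ell2 V"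
    then show "R (\<lambda>v. a * f v) = (\<lambda>v. a * R f v)"
      using R by (intro R_eq) (simp_all add: bounded_operator_scale[OF S])
  next
    fix f assume "f \<in> ell2 V"
    then show "R f \<in> ell2 V"
      using R by simp
    show "ell2_norm V (R f) \<le> (1 / c) * ell2_norm V f"
      using below[of "R f"] R[OF \<open>f \<in> ell2 V\<close>] c(1) by (simp add: pos_le_divide_eq mult.commute)
  qed
  moreover have "R (\<lambda>v. T f v - z * f v) = f \<and> (\<lambda>v. T (R f) v - z * R f v) = f" if "f \<in> ell2 V" for f
    using R[OF that] R_eq[of "?S f" f] that by (simp add: poly_operator_linear)
  ultimately show ?thesis
    unfolding spectrum_def by blast
qed

text \<open>The inner product of \<open>T f\<close> with \<open>f\<close> is real, so only
  \<open>z\<close> contributes to the imaginary part of that of \<open>(T - z) f\<close> with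
  \<open>f\<close>. Cauchy-Schwarz turns this into the lower bound \<open>\<bar>Im z\<bar>\<close>
  for \<open>T - z\<close>.\<close>

lemma spectrum_real:
  assumes "z \<in> spectrum V T"
  shows "Im z = 0"
proof (rule ccontr)
  assume "Im z \<noteq> 0"
  have "\<bar>Im z\<bar> * ell2_norm V f \<le> ell2_norm V (\<lambda>v. T f v - z * f v)" if f: "f \<in> ell2 V" for f
  proof -
    have "ell2_inner V (T f) f = cnj (ell2_inner V (T f) f)"
      using self_adjoint[OF f f] ell2_inner_commute[of V f "T f"] by simp
    then have "Im (ell2_inner V (T f) f) = 0"
      by (metis Reals_cnj_iff complex_is_Real_iff)
    then have "Im (ell2_inner V (\<lambda>v. T f v - z * f v) f) = - Im z * (ell2_norm V f)\<^sup>2"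
      using f by (simp add: ell2_inner_diff_left ell2_inner_scale_left ell2_inner_self
          flip: of_real_power)
    then have "\<bar>Im z\<bar> * (ell2_norm V f)\<^sup>2 \<le> cmod (ell2_inner V (\<lambda>v. T f v - z * f v) f)"
      using abs_Im_le_cmod[of "ell2_inner V (\<lambda>v. T f v - z * f v) f"] by (simp add: abs_mult)
    also have "\<dots> \<le> ell2_norm V (\<lambda>v. T f v - z * f v) * ell2_norm V f"
      using f by (intro ell2_Cauchy_Schwarz) simp_all
    finally have "(\<bar>Im z\<bar> * ell2_norm V f) * ell2_norm V f
      \<le> ell2_norm V (\<lambda>v. T f v - z * f v) * ell2_norm V f"
      by (simp add: power2_eq_square mult.assoc)
    then show ?thesis
      using ell2_norm_nonneg[of V f] by (cases "ell2_norm V f = 0") auto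
  qed
  then show False
    using not_in_spectrumI[of "\<bar>Im z\<bar>" z] assms \<open>Im z \<noteq> 0\<close> by simp
qed

text \<open>In this form it shows that \<open>map_poly cnj p * p\<close> takes the value
  \<open>(cmod (poly p z))\<^sup>2\<close> at a spectral point.\<close>

lemma cnj_spectrum: "z \<in> spectrum V T \<Longrightarrow> cnj z = z"
  using spectrum_real by (simp add: complex_eq_iff)

text \<open>Lower bounds are stable: \<open>T - z\<close> has the lower bound
  \<open>cmod z - C\<close> beyond a bound \<open>C\<close> of \<open>T\<close>, and a lower bound
  \<open>c\<close> at \<open>z\<close> leaves \<open>c - dist w z\<close> at a nearby
  \<open>w\<close>.\<close>

lemma compact_spectrum: "compact (spectrum V T)"
proof -
  obtain C where C: "C > 0" "\<And>f. f \<in> ell2 V \<Longrightarrow> ell2_norm V (T f) \<le> C * ell2_norm V f"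
    using bounded_operator_bound[OF bounded] by metis
  have "cmod z \<le> C" if z: "z \<in> spectrum V T" for z
  proof (rule ccontr)
    assume "\<not> cmod z \<le> C"
    moreover have "(cmod z - C) * ell2_norm V f \<le> ell2_norm V (\<lambda>v. T f v - z * f v)"
      if f: "f \<in> ell2 V" for f
    proof -
      have "cmod z * ell2_norm V f = ell2_norm V (\<lambda>v. T f v - (T f v - z * f v))"
        by (simp add: ell2_norm_scale)
      also have "\<dots> \<le> ell2_norm V (T f) + ell2_norm V (\<lambda>v. T f v - z * f v)"
        using f by (intro ell2_norm_diff_le) simp_all
      finally show ?thesis
        using C(2)[OF f] by (simp add: algebra_simps)
    qed
    ultimately show False
      using not_in_spectrumI[of "cmod z - C" z] z by simp
  qed
  then have "bounded (spectrum V T)"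
    by (auto simp: bounded_iff)
  moreover have "open (- spectrum V T)"
    unfolding open_dist
  proof
    fix z assume "z \<in> - spectrum V T"
    then obtain c where c: "c > 0"
      "\<And>f. f \<in> ell2 V \<Longrightarrow> c * ell2_norm V f \<le> ell2_norm V (\<lambda>v. T f v - z * f v)"
      using spectrum_bounded_below[of z] by (auto simp: poly_operator_linear)
    have "w \<notin> spectrum V T" if w: "dist w z < c" for w
    proof (rule not_in_spectrumI)
      show "c - dist w z > 0"
        using w by simp
      fix f assume f: "f \<in> ell2 V"
      have "c * ell2_norm V f \<le> ell2_norm V (\<lambda>v. (T f v - w * f v) + (w - z) * f v)"
        using c(2)[OF f] by (simp add: algebra_simps)
      also have "\<dots> \<le> ell2_norm V (\<lambda>v. T f v - w * f v) + ell2_norm V (\<lambda>v. (w - z) * f v)"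
        using f by (intro ell2_norm_add_le) simp_all
      also have "\<dots> = ell2_norm V (\<lambda>v. T f v - w * f v) + dist w z * ell2_norm V f"
        by (simp add: ell2_norm_scale dist_norm)
      finally show "(c - dist w z) * ell2_norm V f \<le> ell2_norm V (\<lambda>v. T f v - w * f v)"
        by (simp add: algebra_simps)
    qed
    then show "\<exists>e>0. \<forall>y. dist y z < e \<longrightarrow> y \<in> - spectrum V T"
      using c(1) by blast
  qed
  ultimately show ?thesis
    by (simp add: compact_eq_bounded_closed closed_def)
qed

section \<open>Bounding polynomials in the operator by their values on the spectrum\<close>

text \<open>Over the complex numbers \<open>p\<close> splits into linear factors whose roots avoid
  the spectrum. Each factor is bounded below there, and lower bounds multiply.\<close>

lemma poly_operator_bounded_below:
  assumes "p \<noteq> 0" "\<And>z. z \<in> spectrum V T \<Longrightarrow> poly p z \<noteq> 0"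
  shows "\<exists>c>0. \<forall>f\<in>ell2 V. c * ell2_norm V f \<le> ell2_norm V (poly_operator p T f)"
  using assms
proof (induction "degree p" arbitrary: p)
  case 0
  then obtain a where "p = [:a:]"
    using degree_eq_zeroE[of p] by metis
  moreover from this have "a \<noteq> 0"
    using 0 by simp
  ultimately show ?case
    by (intro exI[of _ "cmod a"]) (simp add: ell2_norm_scale)
next
  case (Suc n)
  then have "\<not> constant (poly p)"
    by (simp add: constant_degree)
  then obtain z where z: "poly p z = 0"
    using fundamental_theorem_of_algebra by blast
  then obtain q where q: "p = [:- z, 1:] * q"
    by (auto simp: poly_eq_0_iff_dvd)
  then have "q \<noteq> 0"
    using Suc.prems by auto
  moreover have "degree q = n"
    using Suc.hyps(2) \<open>q \<noteq> 0\<close> unfolding q by (subst (asm) degree_mult_eq) auto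
  moreover have "poly q w \<noteq> 0" if "w \<in> spectrum V T" for w
    using Suc.prems(2)[OF that] by (auto simp: q)
  ultimately obtain c where c: "c > 0"
    "\<And>f. f \<in> ell2 V \<Longrightarrow> c * ell2_norm V f \<le> ell2_norm V (poly_operator q T f)"
    using Suc.hyps(1)[of q] by blast
  have "z \<notin> spectrum V T"
    using Suc.prems(2) z by blast
  then obtain d where d: "d > 0"
    "\<And>f. f \<in> ell2 V \<Longrightarrow> d * ell2_norm V f \<le> ell2_norm V (poly_operator [:- z, 1:] T f)"
    using spectrum_bounded_below by blast
  have "(d * c) * ell2_norm V f \<le> ell2_norm V (poly_operator p T f)" if f: "f \<in> ell2 V" for f
  proof -
    have "d * (c * ell2_norm V f) \<le> d * ell2_norm V (poly_operator q T f)"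
      using c(2)[OF f] d(1) by simp
    also have "\<dots> \<le> ell2_norm V (poly_operator p T f)"
      unfolding q using d(2)[of "poly_operator q T f"] f by (simp only: poly_operator_mult poly_closed)
    finally show ?thesis
      by (simp add: mult.assoc)
  qed
  then show ?case
    using c d by (intro exI[of _ "d * c"]) auto
qed

text \<open>If \<open>m = \<parallel>p(T)\<parallel>\<close> exceeded \<open>C\<close>, then \<open>p\<^sup>*p - m\<^sup>2\<close> would have no zero on the spectrum, hence
  be bounded below at \<open>T\<close>; this contradicts the existence of almost norming vectors.\<close>

lemma poly_operator_norm_le_aux:
  assumes C: "C \<ge> 0" "\<And>z. z \<in> spectrum V T \<Longrightarrow> cmod (poly p z) \<le> C" and f: "f \<in> ell2 V"
    and nonconst: "map_poly cnj p * p \<noteq> [:complex_of_real ((operator_norm V (poly_operator p T))\<^sup>2):]"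
  shows "ell2_norm V (poly_operator p T f) \<le> C * ell2_norm V f"
proof -
  let ?P = "poly_operator p T" and ?P' = "poly_operator (map_poly cnj p) T"
  define m where "m = operator_norm V ?P"
  have m: "ell2_norm V (?P f) \<le> m * ell2_norm V f" if "f \<in> ell2 V" for f
    unfolding m_def using operator_norm_upper[OF bounded_poly_operator that] .
  have "m \<le> C"
  proof (rule ccontr)
    assume "\<not> m \<le> C"
    then have "m > 0" "C < m"
      using C(1) by auto
    define q where "q = map_poly cnj p * p - [:complex_of_real (m\<^sup>2):]"
    \<comment> \<open>With an empty spectrum, having no spectral zero is vacuous even for the zero
      polynomial; this is the case that \<open>nonconst\<close> excludes.\<close>
    have "q \<noteq> 0"
      using nonconst by (simp add: q_def m_def)
    moreover have "poly q z \<noteq> 0" if z: "z \<in> spectrum V T" for z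
    proof -
      have "poly q z = complex_of_real ((cmod (poly p z))\<^sup>2 - m\<^sup>2)"
        using cnj_spectrum[OF z]
        by (simp add: q_def complex_norm_square mult.commute del: of_real_power)
      moreover have "(cmod (poly p z))\<^sup>2 < m\<^sup>2"
        using C(2)[OF z] \<open>C < m\<close> by (intro power_strict_mono) auto
      ultimately show ?thesis
        by (simp only: of_real_eq_0_iff)
    qed
    ultimately obtain c where c: "c > 0"
      "\<And>f. f \<in> ell2 V \<Longrightarrow> c * ell2_norm V f \<le> ell2_norm V (poly_operator q T f)"
      using poly_operator_bounded_below by blast
    \<comment> \<open>Expanding the squared norm of \<open>q(T) f\<close> and using
      \<open>m^2\<close> as a bound for \<open>?P' ?P\<close> leaves \<open>2 m^2\<close> times the
      squared norm of \<open>?P f\<close> at most \<open>2 m^4 - c^2\<close> times that of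
      \<open>f\<close>. Division by \<open>2 m^2\<close> gives \<open>k < m^2\<close>.\<close>
    define k where "k = m\<^sup>2 - c\<^sup>2 / (2 * m\<^sup>2)"
    have bound: "(ell2_norm V (?P f))\<^sup>2 \<le> k * (ell2_norm V f)\<^sup>2" if f: "f \<in> ell2 V" for f
    proof -
      have "(c * ell2_norm V f)\<^sup>2 \<le> (ell2_norm V (poly_operator q T f))\<^sup>2"
        using c f by (intro power_mono) auto
      also have "poly_operator q T f = (\<lambda>v. ?P' (?P f) v - complex_of_real (m\<^sup>2) * f v)"
        using f by (simp add: q_def poly_operator_diff poly_operator_mult)
      also have "(ell2_norm V \<dots>)\<^sup>2 = (ell2_norm V (?P' (?P f)))\<^sup>2 + (m\<^sup>2 * ell2_norm V f)\<^sup>2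
          - 2 * Re (m\<^sup>2 * ell2_inner V (?P' (?P f)) f)"
        using f by (subst ell2_norm_diff_square)
          (simp_all add: ell2_norm_scale ell2_inner_scale_right norm_power)
      also have "ell2_inner V (?P' (?P f)) f = ell2_inner V (?P f) (?P f)"
        using f by (subst poly_operator_adjoint) (simp_all add: map_poly_map_poly o_def)
      also have "\<dots> = complex_of_real ((ell2_norm V (?P f))\<^sup>2)"
        using f by (simp add: ell2_inner_self)
      also have "Re (m\<^sup>2 * complex_of_real ((ell2_norm V (?P f))\<^sup>2)) = m\<^sup>2 * (ell2_norm V (?P f))\<^sup>2"
        by (simp flip: of_real_power of_real_mult)
      finally have 1: "(c * ell2_norm V f)\<^sup>2 \<le> (ell2_norm V (?P' (?P f)))\<^sup>2 + (m\<^sup>2 * ell2_norm V f)\<^sup>2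
          - 2 * (m\<^sup>2 * (ell2_norm V (?P f))\<^sup>2)" .
      have "ell2_norm V (?P' (?P f)) \<le> m * ell2_norm V (?P f)"
        using m[of "?P f"] f by (simp add: poly_operator_norm_cnj)
      also have "\<dots> \<le> m * (m * ell2_norm V f)"
        using m[OF f] \<open>m > 0\<close> by simp
      finally have "(ell2_norm V (?P' (?P f)))\<^sup>2 \<le> (m\<^sup>2 * ell2_norm V f)\<^sup>2"
        by (intro power_mono) (auto simp: power2_eq_square mult.assoc)
      with 1 have "2 * m\<^sup>2 * (ell2_norm V (?P f))\<^sup>2 \<le> (2 * (m\<^sup>2)\<^sup>2 - c\<^sup>2) * (ell2_norm V f)\<^sup>2"
        by (simp add: power_mult_distrib algebra_simps)
      also have "\<dots> = 2 * m\<^sup>2 * (k * (ell2_norm V f)\<^sup>2)"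
        using \<open>m > 0\<close> by (simp add: k_def field_simps power2_eq_square)
      finally show ?thesis
        using \<open>m > 0\<close> by simp
    qed
    \<comment> \<open>\<open>k\<close> may be negative while an operator bound must not be; both 0
      and \<open>k\<close> lie below \<open>m^2\<close>, so the maximum still contradicts the choice
      of \<open>m\<close>.\<close>
    define k' where "k' = sqrt (max 0 k)"
    have "ell2_norm V (?P f) \<le> k' * ell2_norm V f" if f: "f \<in> ell2 V" for f
    proof (rule power2_le_imp_le)
      have "k * (ell2_norm V f)\<^sup>2 \<le> max 0 k * (ell2_norm V f)\<^sup>2"
        by (intro mult_right_mono) auto
      then show "(ell2_norm V (?P f))\<^sup>2 \<le> (k' * ell2_norm V f)\<^sup>2"
        using bound[OF f] by (simp add: k'_def power_mult_distrib)
    qed (simp add: k'_def)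
    then have "m \<le> k'"
      unfolding m_def by (rule operator_norm_le) (simp_all add: k'_def)
    then have "m\<^sup>2 \<le> max 0 k"
      using \<open>m > 0\<close> power_mono[of m k' 2] by (simp add: k'_def)
    moreover have "0 < m\<^sup>2"
      using \<open>m > 0\<close> by simp
    moreover have "k < m\<^sup>2"
      using \<open>m > 0\<close> c(1) by (simp add: k_def)
    ultimately show False
      by (simp add: max_def split: if_splits)
  qed
  then have "m * ell2_norm V f \<le> C * ell2_norm V f"
    by (intro mult_right_mono) simp_all
  then show ?thesis
    using m[OF f] by linarith
qed

text \<open>If the spectrum is empty, then \<open>T\<close> and \<open>T + 1\<close> both vanish, so the space is trivial.\<close>

theorem poly_operator_norm_le:
  assumes C: "C \<ge> 0" "\<And>z. z \<in> spectrum V T \<Longrightarrow> cmod (poly p z) \<le> C" and f: "f \<in> ell2 V"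
  shows "ell2_norm V (poly_operator p T f) \<le> C * ell2_norm V f"
proof (cases "map_poly cnj p * p = [:complex_of_real ((operator_norm V (poly_operator p T))\<^sup>2):]")
  case False
  then show ?thesis
    using poly_operator_norm_le_aux[OF C f] by blast
next
  case True
  let ?P = "poly_operator p T"
  define m where "m = operator_norm V ?P"
  have "m \<ge> 0"
    unfolding m_def by (rule operator_norm_nonneg[OF bounded_poly_operator])
  have m: "ell2_norm V (?P f) \<le> m * ell2_norm V f"
    unfolding m_def using operator_norm_upper[OF bounded_poly_operator f] .
  show ?thesis
  proof (cases "spectrum V T = {}")
    case False
    then obtain z where z: "z \<in> spectrum V T"
      by blast
    \<comment> \<open>In the exceptional case \<open>p\<close> has constant modulus \<open>m\<close>
      on the spectrum, so a single spectral point gives \<open>m \<le> C\<close>.\<close>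
    then have "complex_of_real ((cmod (poly p z))\<^sup>2) = complex_of_real (m\<^sup>2)"
      using arg_cong[OF True, of "\<lambda>q. poly q z"] cnj_spectrum[OF z]
      by (simp add: complex_norm_square mult.commute m_def del: of_real_power)
    then have "cmod (poly p z) = m"
      using \<open>m \<ge> 0\<close> by (simp only: of_real_eq_iff power2_eq_iff_nonneg norm_ge_zero)
    then have "m * ell2_norm V f \<le> C * ell2_norm V f"
      using C(2)[OF z] by (intro mult_right_mono) simp_all
    then show ?thesis
      using m by linarith
  next
    case empty: True
    \<comment> \<open>Linear polynomials escape the exceptional case: the product with the conjugate
      has degree 2. Over an empty spectrum the bound 0 is admissible.\<close>
    have "ell2_norm V (poly_operator [:a, 1:] T f) \<le> 0 * ell2_norm V f" for a
    proof (rule poly_operator_norm_le_aux)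
      have "degree (map_poly cnj [:a, 1:] * [:a, 1:]) = 2"
        by (subst degree_mult_eq) (auto simp: map_poly_pCons)
      then show "map_poly cnj [:a, 1:] * [:a, 1:]
          \<noteq> [:complex_of_real ((operator_norm V (poly_operator [:a, 1:] T))\<^sup>2):]"
        by (metis degree_pCons_0 zero_neq_numeral)
    qed (use empty f in auto)
    then have zero: "poly_operator [:a, 1:] T f = (\<lambda>v. 0)" for a
      using f by (intro ell2_norm_eq_0[of _ V]) (auto intro: antisym)
    have "f v = 0" for v
      using fun_cong[OF zero[of 0], of v] fun_cong[OF zero[of 1], of v] by (simp add: poly_operator_pCons)
    then have "f = (\<lambda>v. 0)"
      by auto
    then have "ell2_norm V f = 0"
      by simp
    then show ?thesis
      using m by simp
  qed
qed

end

section \<open>The moment problem on a compact set of reals\<close>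

lemma Weierstrass_poly:
  fixes f :: "real \<Rightarrow> real"
  assumes "compact S" "continuous_on S f" "0 < e"
  obtains p where "\<And>x. x \<in> S \<Longrightarrow> \<bar>f x - poly p x\<bar> < e"
proof -
  obtain g where g: "real_polynomial_function g" "\<And>x. x \<in> S \<Longrightarrow> \<bar>f x - g x\<bar> < e"
    using Stone_Weierstrass_real_polynomial_function[OF assms] by metis
  obtain a n where "g = (\<lambda>x. \<Sum>i\<le>n. a i * x ^ i)"
    using real_polynomial_function_imp_sum[OF g(1)] by blast
  then have "g x = poly (\<Sum>i\<le>n. monom (a i) i) x" for x
    by (simp add: poly_sum poly_monom)
  then show ?thesis
    using g(2) that by metis
qed

section \<open>Positive functionals on polynomials over an interval\<close>

lemma poly_bounded_on_interval:
  fixes p :: "real poly"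
  obtains B where "\<And>x. a \<le> x \<Longrightarrow> x \<le> b \<Longrightarrow> \<bar>poly p x\<bar> \<le> B"
proof -
  have "bounded (poly p ` {a..b})"
    by (intro compact_imp_bounded compact_continuous_image continuous_intros) auto
  then show ?thesis
    using that by (metis bounded_iff atLeastAtMost_iff imageI real_norm_def)
qed

text \<open>Integrating \<open>f\<close> against the \<open>n\<close>-th discrete measure is the
  same as applying \<open>L\<close> to the \<open>n\<close>-th Bernstein approximation of
  \<open>f\<close>. Bernstein's theorem and the continuity of \<open>L\<close> then identify the
  limit.\<close>

lemma Hausdorff_moment_prob:
  fixes L :: "real poly \<Rightarrow> real"
  assumes add: "\<And>p q. L (p + q) = L p + L q"
    and smult: "\<And>c p. L (smult c p) = c * L p"
    and pos: "\<And>p. (\<And>x. 0 \<le> x \<Longrightarrow> x \<le> 1 \<Longrightarrow> 0 \<le> poly p x) \<Longrightarrow> 0 \<le> L p"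
    and one: "L 1 = 1"
  obtains M where "prob_space M" "sets M = sets borel" "AE x in M. 0 \<le> x \<and> x \<le> 1"
    "\<And>p. integral\<^sup>L M (poly p) = L p"
proof -
  have L_0: "L 0 = 0"
    using smult[of 0 0] by simp
  have L_sum: "L (\<Sum>i\<in>I. c i) = (\<Sum>i\<in>I. L (c i))" for I :: "nat set" and c
    by (induction I rule: infinite_finite_induct) (simp_all add: L_0 add)
  have L_diff: "L (p - q) = L p - L q" for p q
    using add[of p "smult (-1) q"] smult[of "-1" q] by simp
  have L_const: "L [:c:] = c * L 1" for c
    using smult[of c 1] by simp
  \<comment> \<open>Positivity and \<open>L 1 = 1\<close> make \<open>L\<close> continuous for the
    supremum norm on the interval.\<close>
  have L_bound: "\<bar>L p\<bar> \<le> e" if "\<And>x. 0 \<le> x \<Longrightarrow> x \<le> 1 \<Longrightarrow> \<bar>poly p x\<bar> \<le> e" for p e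
  proof -
    have "0 \<le> L ([:e:] - p)" "0 \<le> L ([:e:] + p)"
      using that by (intro pos; force simp: abs_le_iff)+
    then show ?thesis
      by (simp add: L_diff add L_const one)
  qed
  define b where "b n k = smult (real (n choose k)) ([:0, 1:] ^ k * [:1, -1:] ^ (n - k))" for n k :: nat
  have poly_b: "poly (b n k) x = Bernstein n k x" for n k x
    by (simp add: b_def Bernstein_def)
  have b_nonneg: "0 \<le> L (b n k)" for n k
    by (intro pos) (simp add: poly_b Bernstein_nonneg)
  have "(\<Sum>k\<le>n. b n k) = 1" for n
    by (subst poly_eq_poly_eq_iff[symmetric]) (simp add: fun_eq_iff poly_sum poly_b)
  then have b_sum: "(\<Sum>k\<le>n. L (b n k)) = 1" for n
    using L_sum[of "b n" "{..n}"] one by simp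
  define w where "w n k = (if k \<le> n then L (b n k) else 0)" for n k
  define P where "P n = embed_pmf (w n)" for n
  have pmf_P: "pmf (P n) k = w n k" for n k
    unfolding P_def
  proof (rule pmf_embed_pmf)
    show "0 \<le> w n x" for x
      by (simp add: w_def b_nonneg)
    have "(\<integral>\<^sup>+x. ennreal (w n x) \<partial>count_space UNIV) = (\<Sum>k\<le>n. ennreal (w n k))"
      by (intro nn_integral_count_space') (auto simp: w_def)
    also have "\<dots> = ennreal (\<Sum>k\<le>n. w n k)"
      by (intro sum_ennreal) (auto simp: w_def b_nonneg)
    also have "(\<Sum>k\<le>n. w n k) = 1"
      using b_sum by (simp add: w_def)
    finally show "(\<integral>\<^sup>+x. ennreal (w n x) \<partial>count_space UNIV) = 1"
      by simp
  qed
  have set_P: "set_pmf (P n) \<subseteq> {..n}" for n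
    by (auto simp: set_pmf_eq pmf_P w_def split: if_splits)
  \<comment> \<open>For \<open>n = 0\<close> the node is \<open>0 / 0 = 0\<close>, so every node
    lies in the unit interval.\<close>
  define \<mu> where "\<mu> n = distr (measure_pmf (P n)) borel (\<lambda>k. real k / real n)" for n
  have real_dist: "real_distribution (\<mu> n)" for n
    unfolding \<mu>_def by (rule prob_space.real_distribution_distr[OF prob_space_measure_pmf]) simp
  have integral_\<mu>: "integral\<^sup>L (\<mu> n) f = (\<Sum>k\<le>n. f (real k / real n) * L (b n k))"
    if [measurable]: "f \<in> borel_measurable borel" for f :: "real \<Rightarrow> real" and n
  proof -
    have "integral\<^sup>L (\<mu> n) f = measure_pmf.expectation (P n) (\<lambda>k. f (real k / real n))"
      unfolding \<mu>_def by (subst integral_distr) auto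
    also have "\<dots> = (\<Sum>k\<le>n. f (real k / real n) * pmf (P n) k)"
      using set_P[of n] by (intro integral_measure_pmf_real) auto
    finally show ?thesis
      by (simp add: pmf_P w_def)
  qed
  have "tight \<mu>"
    unfolding tight_def
  proof (intro conjI allI impI real_dist)
    fix e :: real assume "e > 0"
    \<comment> \<open>Tightness is phrased with intervals open on the left, and 0 is a node; hence
      the left endpoint -1.\<close>
    have "measure (\<mu> n) {-1<..1} = 1" for n
    proof -
      interpret real_distribution "\<mu> n"
        by (rule real_dist)
      have "AE k in measure_pmf (P n). real k / real n \<in> {-1<..1}"
        using set_P[of n] by (auto simp: AE_measure_pmf_iff divide_le_eq_1
            intro: less_le_trans[of _ 0])
      then have "AE x in \<mu> n. x \<in> {-1<..1}"
        unfolding \<mu>_def by (subst AE_distr_iff) auto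
      then show ?thesis
        by (subst prob_eq_1) auto
    qed
    then show "\<exists>a b. a < b \<and> (\<forall>n. 1 - e < measure (\<mu> n) {a<..b})"
      using \<open>e > 0\<close> by (intro exI[of _ "-1"] exI[of _ 1]) simp
  qed
  from tight_imp_convergent_subsubsequence[OF this strict_mono_id]
  obtain r N where r: "strict_mono (r :: nat \<Rightarrow> nat)" and N: "real_distribution N"
    and conv: "weak_conv_m (\<mu> \<circ> r) N"
    by auto
  interpret N: real_distribution N
    by (rule N)
  \<comment> \<open>Weak convergence tests bounded continuous functions only. Composing with
    \<open>clamp\<close> makes a polynomial bounded without changing it on the unit
    interval.\<close>
  define clamp where "clamp x = max 0 (min 1 x)" for x :: real
  have cont_clamp: "continuous_on A clamp" for A
    unfolding clamp_def by (intro continuous_intros)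
  have [measurable]: "clamp \<in> borel_measurable borel"
    by (intro borel_measurable_continuous_onI cont_clamp)
  have [measurable]: "poly p \<in> borel_measurable borel" for p :: "real poly"
    by (intro borel_measurable_continuous_onI continuous_intros)
  have clamp_integral: "integral\<^sup>L N (\<lambda>x. poly p (clamp x)) = L p" for p
  proof -
    define f where "f = (\<lambda>x. poly p (clamp x))"
    have f_clamp: "f x = poly p x" if "0 \<le> x" "x \<le> 1" for x
      using that by (simp add: f_def clamp_def)
    have cont_f: "continuous_on A f" for A
      unfolding f_def using cont_clamp by (intro continuous_intros)
    obtain B where "\<And>x. 0 \<le> x \<Longrightarrow> x \<le> 1 \<Longrightarrow> \<bar>poly p x\<bar> \<le> B"
      using poly_bounded_on_interval by metis
    then have f_bound: "norm (f x) \<le> B" for x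
      by (simp add: f_def clamp_def)
    have conv1: "(\<lambda>n. integral\<^sup>L ((\<mu> \<circ> r) n) f) \<longlonglongrightarrow> integral\<^sup>L N f"
    proof (rule weak_conv_imp_integral_bdd_continuous_conv[OF _ N conv _ f_bound])
      show "isCont f x" for x
        using cont_f[of UNIV] by (simp add: continuous_on_eq_continuous_at)
    qed (simp add: real_dist)
    have "(\<lambda>n. integral\<^sup>L (\<mu> n) f) \<longlonglongrightarrow> L p"
    proof (rule LIMSEQ_I)
      fix e :: real assume "e > 0"
      then have "e / 2 > 0"
        by simp
      from Bernstein_Weierstrass[OF cont_f this] obtain m where m:
        "\<And>n x. m \<le> n \<Longrightarrow> x \<in> {0..1} \<Longrightarrow> \<bar>f x - (\<Sum>k\<le>n. f (k / n) * Bernstein n k x)\<bar> < e / 2"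
        by blast
      have "norm (integral\<^sup>L (\<mu> n) f - L p) < e" if "n \<ge> m" for n
      proof -
        let ?q = "\<Sum>k\<le>n. smult (f (real k / real n)) (b n k)"
        have "integral\<^sup>L (\<mu> n) f = L ?q"
          using cont_f by (simp add: integral_\<mu> borel_measurable_continuous_onI L_sum smult)
        moreover have "\<bar>L (p - ?q)\<bar> \<le> e / 2"
        proof (rule L_bound)
          fix x :: real assume "0 \<le> x" "x \<le> 1"
          then show "\<bar>poly (p - ?q) x\<bar> \<le> e / 2"
            using m[OF that, of x] by (simp add: poly_sum poly_b f_clamp)
        qed
        ultimately show ?thesis
          using \<open>e > 0\<close> by (simp add: L_diff abs_minus_commute)
      qed
      then show "\<exists>m. \<forall>n\<ge>m. norm (integral\<^sup>L (\<mu> n) f - L p) < e"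
        by blast
    qed
    from LIMSEQ_subseq_LIMSEQ[OF this r] conv1 show ?thesis
      unfolding f_def[symmetric] by (simp add: o_def LIMSEQ_unique)
  qed
  \<comment> \<open>Pushing the limit forward along \<open>clamp\<close> avoids proving that it is concentrated on \<open>[0, 1]\<close>.\<close>
  show ?thesis
  proof
    show "prob_space (distr N borel clamp)"
      by (intro N.prob_space_distr) simp
    show "AE x in distr N borel clamp. 0 \<le> x \<and> x \<le> 1"
      by (subst AE_distr_iff) (auto simp: clamp_def)
    show "integral\<^sup>L (distr N borel clamp) (poly p) = L p" for p
      by (subst integral_distr) (simp_all add: clamp_integral)
  qed simp
qed

text \<open>Rescale by the affine map \<open>u\<close> from \<open>[a, b]\<close> onto the unit
  interval, with inverse \<open>v\<close>, and normalise by \<open>L 1\<close>. If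
  \<open>L 1 = 0\<close>, positivity forces \<open>L\<close> to vanish and the null measure
  represents it.\<close>

lemma Hausdorff_moment:
  fixes L :: "real poly \<Rightarrow> real"
  assumes add: "\<And>p q. L (p + q) = L p + L q"
    and smult: "\<And>c p. L (smult c p) = c * L p"
    and pos: "\<And>p. (\<And>x. a \<le> x \<Longrightarrow> x \<le> b \<Longrightarrow> 0 \<le> poly p x) \<Longrightarrow> 0 \<le> L p"
    and "a < b"
  obtains M where "finite_measure M" "sets M = sets borel" "AE x in M. a \<le> x \<and> x \<le> b"
    "\<And>p. integral\<^sup>L M (poly p) = L p"
proof (cases "L 1 = 0")
  case True
  have L_diff: "L (p - q) = L p - L q" for p q
    using add[of p "smult (-1) q"] smult[of "-1" q] by simp
  have L_const: "L [:c:] = c * L 1" for c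
    using smult[of c 1] by simp
  have "L p = 0" for p
  proof -
    obtain B where B: "\<And>x. a \<le> x \<Longrightarrow> x \<le> b \<Longrightarrow> \<bar>poly p x\<bar> \<le> B"
      using poly_bounded_on_interval by metis
    have "0 \<le> L ([:B:] - p)" "0 \<le> L ([:B:] + p)"
      using B by (intro pos; force simp: abs_le_iff)+
    then show ?thesis
      by (simp add: L_diff add L_const True)
  qed
  moreover have "AE x in null_measure borel. a \<le> x \<and> x \<le> b"
    by (rule AE_I[of _ _ UNIV]) auto
  ultimately show ?thesis
    by (intro that[of "null_measure borel"]) (simp_all add: finite_measureI)
next
  case False
  have "L 1 \<ge> 0"
    by (rule pos) simp
  with False have c: "L 1 > 0"
    by simp
  define u where "u = [:- a / (b - a), 1 / (b - a):]"
  define v where "v = [:a, b - a:]"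
  have uv: "pcompose v u = [:0, 1:]"
    using \<open>a < b\<close> by (simp add: u_def v_def pcompose_pCons field_simps)
  define L' where "L' p = L (pcompose p u) / L 1" for p
  obtain M where M: "prob_space M" "sets M = sets borel" "AE x in M. 0 \<le> x \<and> x \<le> 1"
    "\<And>p. integral\<^sup>L M (poly p) = L' p"
  proof (rule Hausdorff_moment_prob[of L'])
    fix p :: "real poly"
    assume p: "\<And>x. 0 \<le> x \<Longrightarrow> x \<le> 1 \<Longrightarrow> 0 \<le> poly p x"
    have "0 \<le> L (pcompose p u)"
    proof (rule pos)
      fix x assume x: "a \<le> x" "x \<le> b"
      have "poly u x = (x - a) / (b - a)"
        using \<open>a < b\<close> by (simp add: u_def diff_divide_distrib)
      then have "0 \<le> poly u x" "poly u x \<le> 1"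
        using x \<open>a < b\<close> by simp_all
      then show "0 \<le> poly (pcompose p u) x"
        by (simp add: poly_pcompose p)
    qed
    then show "0 \<le> L' p"
      using c by (simp add: L'_def)
  qed (use c in \<open>simp_all add: L'_def pcompose_add pcompose_smult add smult add_divide_distrib pcompose_1\<close>)
  have [measurable]: "poly p \<in> borel_measurable borel" for p :: "real poly"
    by (intro borel_measurable_continuous_onI continuous_intros)
  have [measurable]: "poly p \<in> measurable M borel" for p :: "real poly"
    by (simp add: measurable_cong_sets[OF M(2) refl])
  interpret M: prob_space M
    by (rule M)
  define M' where "M' = density (distr M borel (poly v)) (\<lambda>_. ennreal (L 1))"
  show ?thesis
  proof
    have "emeasure M' (space M') = ennreal (L 1)"
      by (simp add: M'_def emeasure_density nn_integral_distr M.emeasure_space_1 emeasure_distr)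
    then show "finite_measure M'"
      by (intro finite_measureI) simp
    show "sets M' = sets borel"
      by (simp add: M'_def)
    have "AE x in distr M borel (poly v). a \<le> x \<and> x \<le> b"
    proof (subst AE_distr_iff)
      show "AE x in M. a \<le> poly v x \<and> poly v x \<le> b"
        using M(3)
      proof eventually_elim
        case (elim x)
        then have "x * (b - a) \<le> 1 * (b - a)" "0 \<le> x * (b - a)"
          using \<open>a < b\<close> by (intro mult_right_mono mult_nonneg_nonneg; simp)+
        then show ?case
          by (simp add: v_def)
      qed
    qed simp_all
    then show "AE x in M'. a \<le> x \<and> x \<le> b"
      unfolding M'_def by (subst AE_density) (auto elim: eventually_mono)
    show "integral\<^sup>L M' (poly p) = L p" for p
    proof -
      have "integral\<^sup>L M' (poly p) = L 1 * integral\<^sup>L M (\<lambda>x. poly p (poly v x))"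
        unfolding M'_def using c by (simp add: integral_density integral_distr)
      also have "(\<lambda>x. poly p (poly v x)) = poly (pcompose p v)"
        by (simp add: poly_pcompose fun_eq_iff)
      also have "integral\<^sup>L M \<dots> = L p / L 1"
        unfolding M(4) L'_def by (simp add: uv pcompose_idR flip: pcompose_assoc)
      finally show ?thesis
        using c by simp
    qed
  qed
qed

text \<open>\<open>K\<close> may have gaps. The functional is first represented on an interval
  around \<open>K\<close>; the bound by suprema over \<open>K\<close> then forces the distance to
  \<open>K\<close> to have integral 0.\<close>

theorem compact_moment_problem:
  fixes L :: "real poly \<Rightarrow> real"
  assumes add: "\<And>p q. L (p + q) = L p + L q"
    and smult: "\<And>c p. L (smult c p) = c * L p"
    and bound: "\<And>p e. 0 \<le> e \<Longrightarrow> (\<And>x. x \<in> K \<Longrightarrow> \<bar>poly p x\<bar> \<le> e) \<Longrightarrow> \<bar>L p\<bar> \<le> L 1 * e"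
    and K: "compact K"
  obtains M where "finite_measure M" "sets M = sets borel" "AE x in M. x \<in> K"
    "\<And>p. integral\<^sup>L M (poly p) = L p"
proof -
  have L_diff: "L (p - q) = L p - L q" for p q
    using add[of p "smult (-1) q"] smult[of "-1" q] by simp
  have L_const: "L [:c:] = c * L 1" for c
    using smult[of c 1] by simp
  have L1: "0 \<le> L 1"
    using bound[of 1 1] by simp
  obtain a b where ab: "a < b" "K \<subseteq> {a..b}"
  proof -
    obtain B where "\<And>x. x \<in> K \<Longrightarrow> \<bar>x\<bar> \<le> B"
      using compact_imp_bounded[OF K] by (auto simp: bounded_iff)
    then have "K \<subseteq> {- \<bar>B\<bar> - 1..\<bar>B\<bar> + 1}"
      by fastforce
    then show ?thesis
      by (intro that[of "- \<bar>B\<bar> - 1" "\<bar>B\<bar> + 1"]) auto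
  qed
  obtain M where M: "finite_measure M" "sets M = sets borel" "AE x in M. a \<le> x \<and> x \<le> b"
    "\<And>p. integral\<^sup>L M (poly p) = L p"
  proof (rule Hausdorff_moment[of L a b])
    fix p :: "real poly"
    assume p: "\<And>x. a \<le> x \<Longrightarrow> x \<le> b \<Longrightarrow> 0 \<le> poly p x"
    obtain B where B: "\<And>x. a \<le> x \<Longrightarrow> x \<le> b \<Longrightarrow> \<bar>poly p x\<bar> \<le> B"
      using poly_bounded_on_interval by metis
    have "0 \<le> B"
      using B[of a] ab(1) abs_ge_zero[of "poly p a"] by linarith
    \<comment> \<open>Centring a function with values between 0 and \<open>B\<close> at
      \<open>B / 2\<close> turns the supremum bound into positivity:
      \<open>L 1 * (B / 2) - L p \<le> L 1 * (B / 2)\<close>.\<close>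
    moreover have "\<bar>poly ([:B / 2:] - p) x\<bar> \<le> B / 2" if "x \<in> K" for x
    proof -
      have "a \<le> x" "x \<le> b"
        using that ab(2) by auto
      then show ?thesis
        using B[of x] p[of x] by (auto simp: abs_if)
    qed
    ultimately have "\<bar>L ([:B / 2:] - p)\<bar> \<le> L 1 * (B / 2)"
      by (intro bound) auto
    from abs_le_D1[OF this] show "0 \<le> L p"
      by (simp add: L_diff L_const mult.commute)
  qed (use add smult ab in auto)
  interpret M: finite_measure M
    by (rule M)
  have "AE x in M. x \<in> K"
  \<comment> \<open>\<open>infdist\<close> to the empty set is 0 by convention and would detect
    nothing, so this case is settled by total mass.\<close>
  proof (cases "K = {}")
    case True
    then have "L 1 = 0"
      using bound[of 0 1] by simp
    moreover have "poly 1 = (\<lambda>x::real. 1)"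
      by (simp add: fun_eq_iff)
    ultimately have "measure M (space M) = 0"
      using M(4)[of 1] by simp
    then have "emeasure M (space M) = 0"
      by (simp add: M.emeasure_eq_measure)
    then show ?thesis
      by (intro AE_I[of _ _ "space M"]) auto
  next
    case False
    define g where "g x = infdist x K" for x :: real
    have cont_g: "continuous_on A g" for A
      unfolding g_def by (intro continuous_intros)
    have meas: "f \<in> borel_measurable M" if "continuous_on UNIV f" for f :: "real \<Rightarrow> real"
      using borel_measurable_continuous_onI[OF that] by (simp add: measurable_cong_sets[OF M(2) refl])
    have int: "integrable M f" if f: "continuous_on UNIV f" for f :: "real \<Rightarrow> real"
    proof -
      have "bounded (f ` {a..b})"
        using continuous_on_subset[OF f] by (intro compact_imp_bounded compact_continuous_image) auto
      then obtain B where B: "\<And>x. x \<in> {a..b} \<Longrightarrow> norm (f x) \<le> B"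
        by (metis bounded_iff imageI)
      show ?thesis
      proof (rule M.integrable_const_bound)
        show "AE x in M. norm (f x) \<le> B"
          using M(3) by eventually_elim (use B in auto)
      qed (rule meas[OF f])
    qed
    have int_poly: "integrable M (poly p)" for p
      by (intro int continuous_intros)
    have "integral\<^sup>L M g \<le> 0 + e" if "e > 0" for e
    proof -
      define k where "k = L 1 + 1"
      have k: "k > 0"
        using L1 by (simp add: k_def)
      \<comment> \<open>Since \<open>g\<close> vanishes on \<open>K\<close>, an approximation
        \<open>p\<close> within \<open>d\<close> satisfies \<open>\<bar>p\<bar> \<le> d\<close>
        there. The integral of \<open>g\<close> is then at most
        \<open>L p + d * L 1 \<le> 2 * d * L 1\<close>; the 1 added in \<open>k\<close> avoids a
        division by zero.\<close>
      define d where "d = e / 2 / k"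
      have d: "d > 0"
        using that k by (simp add: d_def)
      obtain p where p: "\<And>x. x \<in> {a..b} \<Longrightarrow> \<bar>g x - poly p x\<bar> < d"
        using Weierstrass_poly[of "{a..b}" g d] cont_g d by auto
      have "\<bar>poly p x\<bar> \<le> d" if "x \<in> K" for x
        using p[of x] that ab(2) by (force simp: g_def)
      then have "\<bar>L p\<bar> \<le> L 1 * d"
        using d by (intro bound) auto
      moreover have "integral\<^sup>L M g \<le> integral\<^sup>L M (poly (p + [:d:]))"
      proof (rule integral_mono_AE)
        show "AE x in M. g x \<le> poly (p + [:d:]) x"
          using M(3)
        proof eventually_elim
          case (elim x)
          then show ?case
            using p[of x] by (simp add: abs_less_iff)
        qed
      qed (auto intro: int int_poly cont_g)
      moreover have "L (p + [:d:]) = L p + d * L 1"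
        using smult[of d 1] by (simp add: add)
      ultimately have "integral\<^sup>L M g \<le> 2 * (d * L 1)"
        unfolding M(4) by (simp add: mult.commute)
      also have "\<dots> \<le> 2 * (d * k)"
        using d by (simp add: k_def)
      also have "\<dots> = e"
        using k by (simp add: d_def)
      finally show ?thesis
        by simp
    qed
    then have "integral\<^sup>L M g \<le> 0"
      by (rule field_le_epsilon)
    moreover have "0 \<le> integral\<^sup>L M g"
      by (intro integral_nonneg_AE) (simp add: g_def infdist_nonneg)
    ultimately have "integral\<^sup>L M g = 0"
      by simp
    then have "AE x in M. g x = 0"
      using integral_nonneg_eq_0_iff_AE[of M g] int[OF cont_g] by (simp add: g_def infdist_nonneg)
    then show ?thesis
      by eventually_elim
        (use in_closed_iff_infdist_zero[OF compact_imp_closed[OF K] False] in \<open>simp add: g_def\<close>)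
  qed
  then show ?thesis
    using that M by blast
qed

section \<open>The continuous functional calculus\<close>

lemma poly_map_poly_of_real:
  "poly (map_poly complex_of_real p) (complex_of_real x) = complex_of_real (poly p x)"
  by (induction p) (simp_all add: map_poly_pCons)

lemma ell2_limit_unique:
  assumes "\<And>n. f n \<in> ell2 V" "g \<in> ell2 V" "h \<in> ell2 V"
    and "(\<lambda>n. ell2_norm V (\<lambda>v. f n v - g v)) \<longlonglongrightarrow> 0"
    and "(\<lambda>n. ell2_norm V (\<lambda>v. f n v - h v)) \<longlonglongrightarrow> 0"
  shows "g = h"
proof -
  have "ell2_norm V (\<lambda>v. g v - h v) \<le> 0"
  proof (rule LIMSEQ_le_const)
    show "(\<lambda>n. ell2_norm V (\<lambda>v. f n v - g v) + ell2_norm V (\<lambda>v. f n v - h v)) \<longlonglongrightarrow> 0"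
      using tendsto_add[OF assms(4,5)] by simp
    have "ell2_norm V (\<lambda>v. g v - h v)
        \<le> ell2_norm V (\<lambda>v. f n v - g v) + ell2_norm V (\<lambda>v. f n v - h v)" for n
      using ell2_norm_dist_triangle[OF assms(2,1,3), of n] ell2_norm_minus_commute[of V g "f n"] by simp
    then show "\<exists>N. \<forall>n\<ge>N. ell2_norm V (\<lambda>v. g v - h v)
        \<le> ell2_norm V (\<lambda>v. f n v - g v) + ell2_norm V (\<lambda>v. f n v - h v)"
      by blast
  qed
  then have "(\<lambda>v. g v - h v) = (\<lambda>v. 0)"
    using assms by (intro ell2_norm_eq_0[of _ V]) (auto intro: antisym)
  then show ?thesis
    by (simp add: fun_eq_iff)
qed

context self_adjoint_operator
begin

text \<open>The spectrum is typed as a set of complex numbers, while Weierstrass approximation and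
  the moment problem live on the reals; \<open>spectrum_real\<close> makes this preimage
  faithful.\<close>

definition real_spectrum :: "real set" where
  "real_spectrum = {x. complex_of_real x \<in> spectrum V T}"

lemma spectrum_eq_of_real:
  assumes "z \<in> spectrum V T"
  obtains x where "x \<in> real_spectrum" "z = complex_of_real x"
proof -
  have "z = complex_of_real (Re z)"
    using spectrum_real[OF assms] by (simp add: complex_eq_iff)
  with assms show ?thesis
    using that[of "Re z"] by (simp add: real_spectrum_def)
qed

lemma compact_real_spectrum: "compact real_spectrum"
proof -
  have "real_spectrum = Re ` spectrum V T"
  proof (intro equalityI subsetI)
    fix x assume "x \<in> real_spectrum"
    then show "x \<in> Re ` spectrum V T"
      by (intro image_eqI[of _ _ "complex_of_real x"]) (simp_all add: real_spectrum_def)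
  qed (auto elim!: spectrum_eq_of_real)
  then show ?thesis
    using compact_spectrum by (auto intro!: compact_continuous_image continuous_intros)
qed

text \<open>On a general compact subset of the plane polynomials are not dense. Here the spectrum is
  real, so \<open>Re h\<close> and \<open>Im h\<close> are approximated separately by real
  polynomials and recombined.\<close>

lemma spectrum_poly_approximation:
  assumes h: "continuous_on (spectrum V T) h"
  obtains p :: "nat \<Rightarrow> complex poly"
  where "uniform_limit (spectrum V T) (\<lambda>n. poly (p n)) h sequentially"
proof -
  have "\<exists>p. \<forall>z\<in>spectrum V T. cmod (poly p z - h z) < e" if "e > 0" for e
  proof -
    have e: "e / 2 > 0"
      using that by simp
    have "continuous_on real_spectrum (\<lambda>x. h (complex_of_real x))"
      by (rule continuous_on_compose2[OF h]) (auto simp: real_spectrum_def intro!: continuous_intros)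
    then have cont: "continuous_on real_spectrum (\<lambda>x. Re (h (complex_of_real x)))"
      "continuous_on real_spectrum (\<lambda>x. Im (h (complex_of_real x)))"
      by (auto intro: continuous_intros)
    obtain p where p: "\<And>x. x \<in> real_spectrum \<Longrightarrow> \<bar>Re (h (complex_of_real x)) - poly p x\<bar> < e / 2"
      using Weierstrass_poly[OF compact_real_spectrum cont(1) e] by metis
    obtain q where q: "\<And>x. x \<in> real_spectrum \<Longrightarrow> \<bar>Im (h (complex_of_real x)) - poly q x\<bar> < e / 2"
      using Weierstrass_poly[OF compact_real_spectrum cont(2) e] by metis
    have "cmod (poly (map_poly complex_of_real p + smult \<i> (map_poly complex_of_real q)) z - h z) < e"
      if z: "z \<in> spectrum V T" for z
    proof -
      obtain x where x: "x \<in> real_spectrum" "z = complex_of_real x"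
        using spectrum_eq_of_real[OF z] .
      let ?d = "poly (map_poly complex_of_real p + smult \<i> (map_poly complex_of_real q)) z - h z"
      have "\<bar>Re ?d\<bar> < e / 2" "\<bar>Im ?d\<bar> < e / 2"
        using p[OF x(1)] q[OF x(1)] by (simp_all add: x(2) poly_map_poly_of_real abs_minus_commute)
      then show ?thesis
        using cmod_le[of ?d] by linarith
    qed
    then show ?thesis
      by blast
  qed
  then have "\<exists>p. \<forall>z\<in>spectrum V T. cmod (poly p z - h z) < 1 / real (Suc n)" for n
    by simp
  then obtain p where p: "\<And>n z. z \<in> spectrum V T \<Longrightarrow> cmod (poly (p n) z - h z) < 1 / real (Suc n)"
    by metis
  have "uniform_limit (spectrum V T) (\<lambda>n. poly (p n)) h sequentially"
  proof (rule uniform_limitI)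
    fix e :: real assume "e > 0"
    with order_tendstoD(2)[OF LIMSEQ_inverse_real_of_nat this]
    have "\<forall>\<^sub>F n in sequentially. 1 / real (Suc n) < e"
      by (simp add: inverse_eq_divide)
    then show "\<forall>\<^sub>F n in sequentially. \<forall>z\<in>spectrum V T. dist (poly (p n) z) (h z) < e"
    proof eventually_elim
      case (elim n)
      then show ?case
        using p[of _ n] by (fastforce simp: dist_norm)
    qed
  qed
  then show ?thesis
    by (rule that)
qed

section \<open>Existence and limits of the functional calculus\<close>

lemma poly_operator_dist_le:
  assumes "e \<ge> 0" "\<And>z. z \<in> spectrum V T \<Longrightarrow> cmod (poly p z - poly q z) \<le> e" "f \<in> ell2 V"
  shows "ell2_norm V (\<lambda>v. poly_operator p T f v - poly_operator q T f v) \<le> e * ell2_norm V f"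
  using poly_operator_norm_le[of e "p - q" f] assms by (simp add: poly_operator_diff)

text \<open>Gives content to the \<open>SOME\<close> in \<open>functional_calculus\<close>. A
  witness is built vector by vector along one sequence \<open>p\<close>; \<open>close\<close> then
  makes the convergence uniform in the vector and independent of the sequence.\<close>

lemma functional_calculus_exists:
  assumes h: "continuous_on (spectrum V T) h"
  shows "\<exists>S. bounded_operator V S \<and>
        (\<forall>p :: nat \<Rightarrow> complex poly.
           uniform_limit (spectrum V T) (\<lambda>n. poly (p n)) h sequentially \<longrightarrow>
           (\<lambda>n. operator_norm V (\<lambda>f v. poly_operator (p n) T f v - S f v)) \<longlonglongrightarrow> 0)"
proof -
  obtain p :: "nat \<Rightarrow> complex poly"
    where p: "uniform_limit (spectrum V T) (\<lambda>n. poly (p n)) h sequentially"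
    using spectrum_poly_approximation[OF h] .
  have p_close: "\<exists>N. \<forall>n\<ge>N. \<forall>z\<in>spectrum V T. cmod (poly (p n) z - h z) < e" if "e > 0" for e
    using p that by (simp add: uniform_limit_sequentially_iff dist_norm)
  have "\<forall>f\<in>ell2 V. \<exists>g. g \<in> ell2 V \<and>
      (\<lambda>n. ell2_norm V (\<lambda>v. poly_operator (p n) T f v - g v)) \<longlonglongrightarrow> 0"
  proof
    fix f assume f: "f \<in> ell2 V"
    obtain g where "g \<in> ell2 V" "(\<lambda>n. ell2_norm V (\<lambda>v. poly_operator (p n) T f v - g v)) \<longlonglongrightarrow> 0"
    proof (rule ell2_complete[of "\<lambda>n. poly_operator (p n) T f" V])
      fix e :: real assume "e > 0"
      define k where "k = ell2_norm V f + 1"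
      define d where "d = e / 2 / k"
      have k: "k > 0"
        using ell2_norm_nonneg[of V f] unfolding k_def by linarith
      then have d: "d > 0"
        using \<open>e > 0\<close> by (simp add: d_def)
      obtain N where N: "\<forall>n\<ge>N. \<forall>z\<in>spectrum V T. cmod (poly (p n) z - h z) < d"
        using p_close[OF d] by blast
      have "ell2_norm V (\<lambda>v. poly_operator (p m) T f v - poly_operator (p n) T f v) \<le> e"
        if "m \<ge> N" "n \<ge> N" for m n
      proof -
        have "cmod (poly (p m) z - poly (p n) z) \<le> 2 * d" if z: "z \<in> spectrum V T" for z
        proof -
          have "cmod (poly (p m) z - h z) < d" "cmod (poly (p n) z - h z) < d"
            using N \<open>m \<ge> N\<close> \<open>n \<ge> N\<close> z by blast+
          moreover have "cmod (poly (p m) z - poly (p n) z)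
              \<le> cmod (poly (p m) z - h z) + cmod (poly (p n) z - h z)"
            using norm_triangle_ineq4[of "poly (p m) z - h z" "poly (p n) z - h z"] by simp
          ultimately show ?thesis
            by linarith
        qed
        then have "ell2_norm V (\<lambda>v. poly_operator (p m) T f v - poly_operator (p n) T f v)
            \<le> 2 * d * ell2_norm V f"
          using d f by (intro poly_operator_dist_le) auto
        also have "\<dots> \<le> 2 * d * k"
          using d by (simp add: k_def)
        also have "\<dots> = e"
          using k by (simp add: d_def)
        finally show ?thesis .
      qed
      then show "\<exists>N. \<forall>m\<ge>N. \<forall>n\<ge>N.
          ell2_norm V (\<lambda>v. poly_operator (p m) T f v - poly_operator (p n) T f v) \<le> e"
        by blast
    qed (use f in auto)
    then show "\<exists>g. g \<in> ell2 V \<and>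
        (\<lambda>n. ell2_norm V (\<lambda>v. poly_operator (p n) T f v - g v)) \<longlonglongrightarrow> 0"
      by blast
  qed
  from bchoice[OF this] obtain S where S_lim: "\<forall>f\<in>ell2 V. S f \<in> ell2 V \<and>
      (\<lambda>n. ell2_norm V (\<lambda>v. poly_operator (p n) T f v - S f v)) \<longlonglongrightarrow> 0" ..
  then have S[simp]: "\<And>f. f \<in> ell2 V \<Longrightarrow> S f \<in> ell2 V"
    by blast
  have lim: "(\<lambda>n. ell2_norm V (\<lambda>v. poly_operator (p n) T f v - S f v)) \<longlonglongrightarrow> 0"
    if "f \<in> ell2 V" for f
    using S_lim that by blast
  \<comment> \<open>The index \<open>n\<close> used for comparison depends on \<open>f\<close>, but
    the resulting constant \<open>e\<close> does not. Hence pointwise limits along \<open>p\<close>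
    yield operator norm estimates for every \<open>q\<close>, and with \<open>e = 1\<close> the
    boundedness of \<open>S\<close>.\<close>
  have close: "ell2_norm V (\<lambda>v. poly_operator q T f v - S f v) \<le> e * ell2_norm V f"
    if q: "\<And>z. z \<in> spectrum V T \<Longrightarrow> cmod (poly q z - h z) \<le> e" and "e \<ge> 0" and f: "f \<in> ell2 V"
    for q e f
  proof (rule field_le_epsilon)
    fix r :: real assume "r > 0"
    define d where "d = r / (ell2_norm V f + 1)"
    have n1: "ell2_norm V f + 1 > 0"
      using ell2_norm_nonneg[of V f] by linarith
    then have d: "d > 0"
      using \<open>r > 0\<close> by (simp add: d_def)
    obtain N where N: "\<forall>n\<ge>N. \<forall>z\<in>spectrum V T. cmod (poly (p n) z - h z) < d"
      using p_close[OF d] by blast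
    have "\<forall>\<^sub>F n in sequentially. n \<ge> N \<and> ell2_norm V (\<lambda>v. poly_operator (p n) T f v - S f v) < d"
      using order_tendstoD(2)[OF lim[OF f] d] by (intro eventually_conj eventually_ge_at_top)
    from eventually_happens'[OF sequentially_bot this]
    obtain n where n: "n \<ge> N" "ell2_norm V (\<lambda>v. poly_operator (p n) T f v - S f v) < d"
      by blast
    have "ell2_norm V (\<lambda>v. poly_operator q T f v - S f v)
      \<le> ell2_norm V (\<lambda>v. poly_operator q T f v - poly_operator (p n) T f v)
        + ell2_norm V (\<lambda>v. poly_operator (p n) T f v - S f v)"
      using f by (intro ell2_norm_dist_triangle) simp_all
    also have "ell2_norm V (\<lambda>v. poly_operator q T f v - poly_operator (p n) T f v)
        \<le> (e + d) * ell2_norm V f"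
    proof (rule poly_operator_dist_le)
      fix z assume z: "z \<in> spectrum V T"
      have "cmod (poly q z - poly (p n) z) \<le> cmod (poly q z - h z) + cmod (poly (p n) z - h z)"
        using norm_triangle_ineq4[of "poly q z - h z" "poly (p n) z - h z"] by simp
      moreover have "cmod (poly (p n) z - h z) < d"
        using N n(1) z by blast
      ultimately show "cmod (poly q z - poly (p n) z) \<le> e + d"
        using q[OF z] by linarith
    qed (use \<open>e \<ge> 0\<close> d f in auto)
    finally have "ell2_norm V (\<lambda>v. poly_operator q T f v - S f v)
        \<le> e * ell2_norm V f + d * (ell2_norm V f + 1)"
      using n(2) by (simp add: algebra_simps)
    then show "ell2_norm V (\<lambda>v. poly_operator q T f v - S f v) \<le> e * ell2_norm V f + r"
      using n1 by (simp add: d_def)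
  qed
  have bounded_S: "bounded_operator V S"
    unfolding bounded_operator_def
  proof (intro conjI ballI allI)
    fix f g assume f: "f \<in> ell2 V" and g: "g \<in> ell2 V"
    show "S (\<lambda>v. f v + g v) = (\<lambda>v. S f v + S g v)"
    proof (rule ell2_limit_unique)
      show "(\<lambda>n. ell2_norm V (\<lambda>v. poly_operator (p n) T (\<lambda>v. f v + g v) v - S (\<lambda>v. f v + g v) v))
          \<longlonglongrightarrow> 0"
        using f g by (intro lim) simp
      show "(\<lambda>n. ell2_norm V (\<lambda>v. poly_operator (p n) T (\<lambda>v. f v + g v) v - (S f v + S g v)))
          \<longlonglongrightarrow> 0"
      proof (rule tendsto_sandwich[OF _ _ tendsto_const])
        show "(\<lambda>n. ell2_norm V (\<lambda>v. poly_operator (p n) T f v - S f v)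
            + ell2_norm V (\<lambda>v. poly_operator (p n) T g v - S g v)) \<longlonglongrightarrow> 0"
          using tendsto_add[OF lim[OF f] lim[OF g]] by simp
        have "ell2_norm V (\<lambda>v. poly_operator (p n) T (\<lambda>v. f v + g v) v - (S f v + S g v))
            \<le> ell2_norm V (\<lambda>v. poly_operator (p n) T f v - S f v)
              + ell2_norm V (\<lambda>v. poly_operator (p n) T g v - S g v)" for n
          using ell2_norm_add_le[of "\<lambda>v. poly_operator (p n) T f v - S f v" V
              "\<lambda>v. poly_operator (p n) T g v - S g v"] f g
          by (simp add: poly_operator_vector_add algebra_simps)
        then show "\<forall>\<^sub>F n in sequentially.
            ell2_norm V (\<lambda>v. poly_operator (p n) T (\<lambda>v. f v + g v) v - (S f v + S g v))
            \<le> ell2_norm V (\<lambda>v. poly_operator (p n) T f v - S f v)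
              + ell2_norm V (\<lambda>v. poly_operator (p n) T g v - S g v)"
          by simp
      qed simp
    qed (use f g in simp_all)
  next
    fix c f assume f: "f \<in> ell2 V"
    show "S (\<lambda>v. c * f v) = (\<lambda>v. c * S f v)"
    proof (rule ell2_limit_unique)
      show "(\<lambda>n. ell2_norm V (\<lambda>v. poly_operator (p n) T (\<lambda>v. c * f v) v - S (\<lambda>v. c * f v) v))
          \<longlonglongrightarrow> 0"
        using f by (intro lim) simp
      have "ell2_norm V (\<lambda>v. poly_operator (p n) T (\<lambda>v. c * f v) v - c * S f v)
          = cmod c * ell2_norm V (\<lambda>v. poly_operator (p n) T f v - S f v)" for n
        using f by (simp add: poly_operator_vector_scale ell2_norm_scale flip: right_diff_distrib)
      then show "(\<lambda>n. ell2_norm V (\<lambda>v. poly_operator (p n) T (\<lambda>v. c * f v) v - c * S f v)) \<longlonglongrightarrow> 0"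
        using tendsto_mult_left[OF lim[OF f], of "cmod c"] by simp
    qed (use f in simp_all)
  next
    obtain N where N: "\<forall>n\<ge>N. \<forall>z\<in>spectrum V T. cmod (poly (p n) z - h z) < 1"
      using p_close[of 1] by auto
    obtain C where C: "C > 0"
      "\<And>f. f \<in> ell2 V \<Longrightarrow> ell2_norm V (poly_operator (p N) T f) \<le> C * ell2_norm V f"
      using bounded_operator_bound[OF bounded_poly_operator] by metis
    have "ell2_norm V (S f) \<le> (C + 1) * ell2_norm V f" if f: "f \<in> ell2 V" for f
    proof -
      have "ell2_norm V (\<lambda>v. poly_operator (p N) T f v - S f v) \<le> 1 * ell2_norm V f"
        using N f by (intro close) (auto intro: less_imp_le)
      moreover have "ell2_norm V (S f) \<le> ell2_norm V (poly_operator (p N) T f)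
          + ell2_norm V (\<lambda>v. poly_operator (p N) T f v - S f v)"
        using ell2_norm_diff_le[of "poly_operator (p N) T f" V
            "\<lambda>v. poly_operator (p N) T f v - S f v"] f by simp
      ultimately show ?thesis
        using C(2)[OF f] by (simp add: distrib_right)
    qed
    then show "\<exists>C. \<forall>f\<in>ell2 V. ell2_norm V (S f) \<le> C * ell2_norm V f"
      by blast
  qed simp
  moreover have "(\<lambda>n. operator_norm V (\<lambda>f v. poly_operator (q n) T f v - S f v)) \<longlonglongrightarrow> 0"
    if q: "uniform_limit (spectrum V T) (\<lambda>n. poly (q n)) h sequentially" for q
  proof (rule LIMSEQ_I)
    fix e :: real assume "e > 0"
    then have "e / 2 > 0"
      by simp
    then obtain N where N: "\<And>n z. n \<ge> N \<Longrightarrow> z \<in> spectrum V T \<Longrightarrow> cmod (poly (q n) z - h z) < e / 2"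
      using q unfolding uniform_limit_sequentially_iff dist_norm by metis
    have "norm (operator_norm V (\<lambda>f v. poly_operator (q n) T f v - S f v) - 0) < e" if "n \<ge> N" for n
    proof -
      have "operator_norm V (\<lambda>f v. poly_operator (q n) T f v - S f v) \<le> e / 2"
        using N[OF that] \<open>e > 0\<close> by (intro operator_norm_le close) (auto intro: less_imp_le)
      moreover have "0 \<le> operator_norm V (\<lambda>f v. poly_operator (q n) T f v - S f v)"
        by (intro operator_norm_nonneg bounded_operator_difference bounded_poly_operator bounded_S)
      ultimately show ?thesis
        using \<open>e > 0\<close> by simp
    qed
    then show "\<exists>N. \<forall>n\<ge>N. norm (operator_norm V (\<lambda>f v. poly_operator (q n) T f v - S f v) - 0) < e"
      by blast
  qed
  ultimately show ?thesis
    by blast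
qed

lemma
  assumes "continuous_on (spectrum V T) h"
  shows bounded_functional_calculus: "bounded_operator V (functional_calculus V T h)"
    and functional_calculus_operator_norm:
      "uniform_limit (spectrum V T) (\<lambda>n. poly (p n)) h sequentially \<Longrightarrow>
        (\<lambda>n. operator_norm V (\<lambda>f v. poly_operator (p n) T f v - functional_calculus V T h f v)) \<longlonglongrightarrow> 0"
  using someI_ex[OF functional_calculus_exists[OF assms]] unfolding functional_calculus_def by auto

lemma functional_calculus_limit:
  assumes h: "continuous_on (spectrum V T) h"
    and p: "uniform_limit (spectrum V T) (\<lambda>n. poly (p n)) h sequentially" and f: "f \<in> ell2 V"
  shows "(\<lambda>n. ell2_norm V (\<lambda>v. poly_operator (p n) T f v - functional_calculus V T h f v)) \<longlonglongrightarrow> 0"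
proof (rule tendsto_sandwich[OF _ _ tendsto_const])
  let ?N = "\<lambda>n. operator_norm V (\<lambda>f v. poly_operator (p n) T f v - functional_calculus V T h f v)"
  show "(\<lambda>n. ?N n * ell2_norm V f) \<longlonglongrightarrow> 0"
    using tendsto_mult_right[OF functional_calculus_operator_norm[OF h p], of "ell2_norm V f"] by simp
  have "ell2_norm V (\<lambda>v. poly_operator (p n) T f v - functional_calculus V T h f v) \<le> ?N n * ell2_norm V f"
    for n
    using f by (intro operator_norm_upper bounded_operator_difference
        bounded_poly_operator bounded_functional_calculus h)
  then show "\<forall>\<^sub>F n in sequentially.
      ell2_norm V (\<lambda>v. poly_operator (p n) T f v - functional_calculus V T h f v) \<le> ?N n * ell2_norm V f"
    by simp
qed simp

lemma functional_calculus_inner_limit: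
  assumes h: "continuous_on (spectrum V T) h"
    and p: "uniform_limit (spectrum V T) (\<lambda>n. poly (p n)) h sequentially" and f: "f \<in> ell2 V"
  shows "(\<lambda>n. ell2_inner V (poly_operator (p n) T f) f) \<longlonglongrightarrow> ell2_inner V (functional_calculus V T h f) f"
proof (rule Lim_transform2[OF tendsto_const])
  let ?d = "\<lambda>n v. poly_operator (p n) T f v - functional_calculus V T h f v"
  have S: "functional_calculus V T h f \<in> ell2 V"
    using bounded_operator_closed[OF bounded_functional_calculus[OF h] f] .
  show "(\<lambda>n. ell2_inner V (functional_calculus V T h f) f - ell2_inner V (poly_operator (p n) T f) f) \<longlonglongrightarrow> 0"
  proof (rule Lim_null_comparison)
    show "(\<lambda>n. ell2_norm V (?d n) * ell2_norm V f) \<longlonglongrightarrow> 0"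
      using tendsto_mult_right[OF functional_calculus_limit[OF h p f], of "ell2_norm V f"] by simp
    have "cmod (ell2_inner V (functional_calculus V T h f) f - ell2_inner V (poly_operator (p n) T f) f)
        \<le> ell2_norm V (?d n) * ell2_norm V f" for n
      using ell2_Cauchy_Schwarz[of "?d n" V f] f S
      by (simp add: ell2_inner_diff_left norm_minus_commute)
    then show "\<forall>\<^sub>F n in sequentially.
        norm (ell2_inner V (functional_calculus V T h f) f - ell2_inner V (poly_operator (p n) T f) f)
        \<le> ell2_norm V (?d n) * ell2_norm V f"
      by simp
  qed
qed

text \<open>The constant sequence \<open>p\<close> is an admissible approximation of
  \<open>poly p\<close>.\<close>

lemma functional_calculus_poly:
  assumes "f \<in> ell2 V"
  shows "functional_calculus V T (poly p) f = poly_operator p T f"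
proof (rule ell2_limit_unique)
  have c: "continuous_on (spectrum V T) (poly p)"
    by (intro continuous_intros)
  show "(\<lambda>n. ell2_norm V (\<lambda>v. poly_operator p T f v - functional_calculus V T (poly p) f v)) \<longlonglongrightarrow> 0"
    by (rule functional_calculus_limit[OF c _ assms]) (simp add: uniform_limit_sequentially_iff)
  show "functional_calculus V T (poly p) f \<in> ell2 V"
    by (rule bounded_operator_closed[OF bounded_functional_calculus[OF c] assms])
qed (use assms in simp_all)

end

section \<open>Finite Borel measures on compact sets\<close>

lemma space_eq_of_sets_restrict:
  assumes "sets M = sets (restrict_space borel K)"
  shows "space M = K"
  using sets_eq_imp_space_eq[OF assms] by (simp add: space_restrict_space)

lemma measurable_continuous_restrict:
  fixes h :: "'a::topological_space \<Rightarrow> 'b::topological_space"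
  assumes "sets M = sets (restrict_space borel K)" "continuous_on K h"
  shows "h \<in> borel_measurable M"
  using borel_measurable_continuous_on_restrict[OF assms(2)]
  by (simp add: measurable_cong_sets[OF assms(1) refl])

lemma integrable_continuous_compact:
  fixes h :: "'a::topological_space \<Rightarrow> 'b::{banach, second_countable_topology}"
  assumes K: "compact K" and M: "finite_measure M" "sets M = sets (restrict_space borel K)"
    and h: "continuous_on K h"
  shows "integrable M h"
proof -
  obtain B where B: "\<And>x. x \<in> K \<Longrightarrow> norm (h x) \<le> B"
    using compact_imp_bounded[OF compact_continuous_image[OF h K]] by (metis bounded_iff imageI)
  show ?thesis
  proof (rule finite_measure.integrable_const_bound[OF M(1)])
    show "AE x in M. norm (h x) \<le> B"
      using B by (intro AE_I2) (simp add: space_eq_of_sets_restrict[OF M(2)])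
  qed (rule measurable_continuous_restrict[OF M(2) h])
qed

lemma integral_uniform_limit:
  fixes f :: "nat \<Rightarrow> 'a::topological_space \<Rightarrow> 'b::{banach, second_countable_topology}"
  assumes K: "compact K" and M: "finite_measure M" "sets M = sets (restrict_space borel K)"
    and f: "\<And>n. continuous_on K (f n)" and h: "continuous_on K h"
    and lim: "uniform_limit K f h sequentially"
  shows "(\<lambda>n. integral\<^sup>L M (f n)) \<longlonglongrightarrow> integral\<^sup>L M h"
proof (rule LIMSEQ_I)
  interpret finite_measure M
    by (rule M)
  note int = integrable_continuous_compact[OF K M]
  fix e :: real assume "e > 0"
  define k where "k = measure M (space M) + 1"
  have k: "k > 0"
    using measure_nonneg[of M "space M"] unfolding k_def by linarith
  then have "e / k > 0"
    using \<open>e > 0\<close> by simp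
  then obtain N where N: "\<And>n x. n \<ge> N \<Longrightarrow> x \<in> K \<Longrightarrow> norm (f n x - h x) < e / k"
    using lim unfolding uniform_limit_sequentially_iff dist_norm by metis
  have "norm (integral\<^sup>L M (f n) - integral\<^sup>L M h) < e" if "n \<ge> N" for n
  proof -
    have "integral\<^sup>L M (f n) - integral\<^sup>L M h = (\<integral>x. f n x - h x \<partial>M)"
      by (simp add: int f h)
    also have "norm \<dots> \<le> (\<integral>x. norm (f n x - h x) \<partial>M)"
      by (rule integral_norm_bound)
    also have "\<dots> \<le> (\<integral>x. e / k \<partial>M)"
    proof (rule integral_mono)
      show "integrable M (\<lambda>x. norm (f n x - h x))"
        by (intro integrable_norm Bochner_Integration.integrable_diff int f h)
      show "norm (f n x - h x) \<le> e / k" if "x \<in> space M" for x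
        using N[OF \<open>n \<ge> N\<close>] that by (simp add: space_eq_of_sets_restrict[OF M(2)] less_imp_le)
    qed simp
    also have "\<dots> = measure M (space M) * (e / k)"
      by simp
    also have "\<dots> < k * (e / k)"
      using \<open>e / k > 0\<close> by (intro mult_strict_right_mono) (simp_all add: k_def)
    also have "\<dots> = e"
      using k by simp
    finally show ?thesis .
  qed
  then show "\<exists>N. \<forall>n\<ge>N. norm (integral\<^sup>L M (f n) - integral\<^sup>L M h) < e"
    by blast
qed

text \<open>These continuous functions equal 1 on \<open>B\<close> and vanish eventually at each
  point outside, where the distance to a closed nonempty set is positive. Dominated convergence
  applies with the bound 1.\<close>

lemma measure_closed_limit:
  fixes B :: "'a::metric_space set"
  assumes M: "finite_measure M" "sets M = sets (restrict_space borel K)"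
    and B: "closed B" "B \<noteq> {}"
  shows "(\<lambda>n. \<integral>x. max 0 (1 - real n * infdist x B) \<partial>M) \<longlonglongrightarrow> measure M (K \<inter> B)"
proof -
  interpret finite_measure M
    by (rule M)
  have space: "space M = K"
    by (rule space_eq_of_sets_restrict[OF M(2)])
  have KB: "K \<inter> B \<in> sets M"
    using B by (auto simp: M(2) sets_restrict_space)
  have "(\<lambda>n. \<integral>x. max 0 (1 - real n * infdist x B) \<partial>M) \<longlonglongrightarrow> (\<integral>x. indicator (K \<inter> B) x \<partial>M)"
  proof (rule integral_dominated_convergence[where w = "\<lambda>_. 1"])
    show "(\<lambda>x. max 0 (1 - real n * infdist x B)) \<in> borel_measurable M" for n
      by (intro measurable_continuous_restrict[OF M(2)] continuous_intros)
    show "AE x in M. (\<lambda>n. max 0 (1 - real n * infdist x B)) \<longlonglongrightarrow> indicator (K \<inter> B) x"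
    proof (rule AE_I2)
      fix x assume x: "x \<in> space M"
      show "(\<lambda>n. max 0 (1 - real n * infdist x B)) \<longlonglongrightarrow> indicator (K \<inter> B) x"
      proof (cases "x \<in> B")
        case True
        then show ?thesis
          using x space by simp
      next
        case False
        then have pos: "infdist x B > 0"
          using infdist_pos_not_in_closed[OF B] by simp
        then obtain N :: nat where N: "1 / infdist x B < real N"
          using reals_Archimedean2 by blast
        have "max 0 (1 - real n * infdist x B) = 0" if "n \<ge> N" for n
        proof -
          have "1 / infdist x B \<le> real n"
            using N that by linarith
          then show ?thesis
            using pos by (simp add: pos_divide_le_eq)
        qed
        then have "\<forall>\<^sub>F n in sequentially. max 0 (1 - real n * infdist x B) = 0"
          by (auto simp: eventually_sequentially)
        then show ?thesis
          using False by (simp add: tendsto_eventually)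
      qed
    qed
    show "AE x in M. norm (max 0 (1 - real n * infdist x B)) \<le> 1" for n
      by (intro AE_I2) (simp add: infdist_nonneg)
  qed (use KB in simp_all)
  then show ?thesis
    using KB sets.sets_into_space[OF KB] by (simp add: Int_absorb2 space)
qed

text \<open>A Dynkin argument on the intersection-stable class of closed sets, carried out for a
  signed combination directly, so that each linear relation between spectral measures becomes an
  instance.\<close>

lemma measure_combination_eq_0:
  fixes M :: "'i \<Rightarrow> 'a::metric_space measure"
  assumes "finite I"
    and M: "\<And>i. i \<in> I \<Longrightarrow> finite_measure (M i)"
      "\<And>i. i \<in> I \<Longrightarrow> sets (M i) = sets (restrict_space borel K)"
    and zero: "\<And>h::'a \<Rightarrow> real. continuous_on K h \<Longrightarrow> (\<Sum>i\<in>I. c i * integral\<^sup>L (M i) h) = 0"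
    and A: "A \<in> sets (restrict_space borel K)"
  shows "(\<Sum>i\<in>I. c i * measure (M i) A) = 0"
proof -
  obtain B where B: "B \<in> sets borel" "A = K \<inter> B"
    using A by (auto simp: sets_restrict_space)
  have sets_M: "K \<inter> B \<in> sets (M i)" if "i \<in> I" "B \<in> sets borel" for i B
    using that by (auto simp: M(2) sets_restrict_space)
  have space: "space (M i) = K" if "i \<in> I" for i
    by (rule space_eq_of_sets_restrict[OF M(2)[OF that]])
  have sigma: "sigma_sets UNIV (Collect closed) = sets (borel :: 'a measure)"
    by (simp add: borel_eq_closed)
  have "Int_stable (Collect closed :: 'a set set)" "Collect closed \<subseteq> Pow (UNIV :: 'a set)"
    "B \<in> sigma_sets UNIV (Collect closed)"
    using B(1) by (auto simp: Int_stable_def sigma)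
  then have "(\<Sum>i\<in>I. c i * measure (M i) (K \<inter> B)) = 0"
  proof (induction rule: sigma_sets_induct_disjoint)
    case (basic B)
    show ?case
    proof (cases "B = {}")
      case False
      let ?h = "\<lambda>n x. max 0 (1 - real n * infdist x B)"
      have "(\<lambda>n. \<Sum>i\<in>I. c i * integral\<^sup>L (M i) (?h n)) \<longlonglongrightarrow> (\<Sum>i\<in>I. c i * measure (M i) (K \<inter> B))"
        using basic False by (intro tendsto_intros measure_closed_limit M) auto
      moreover have "(\<Sum>i\<in>I. c i * integral\<^sup>L (M i) (?h n)) = 0" for n
        by (intro zero continuous_intros)
      ultimately show ?thesis
        by (simp add: LIMSEQ_const_iff)
    qed simp
  next
    case (compl B)
    \<comment> \<open>Total masses are written as integrals of the constant 1, which makes their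
      combination vanish by \<open>zero\<close>.\<close>
    have "measure (M i) (K \<inter> (UNIV - B)) = integral\<^sup>L (M i) (\<lambda>x. 1) - measure (M i) (K \<inter> B)"
      if "i \<in> I" for i
    proof -
      have "K \<inter> (UNIV - B) = space (M i) - (K \<inter> B)"
        using space[OF that] by auto
      then show ?thesis
        using finite_measure.finite_measure_compl[OF M(1)[OF that] sets_M[OF that, of B]] compl(1)
        by (simp add: sigma)
    qed
    then have "(\<Sum>i\<in>I. c i * measure (M i) (K \<inter> (UNIV - B)))
      = (\<Sum>i\<in>I. c i * integral\<^sup>L (M i) (\<lambda>x. 1)) - (\<Sum>i\<in>I. c i * measure (M i) (K \<inter> B))"
      by (simp only: right_diff_distrib sum_subtractf cong: sum.cong)
    then show ?case
      using compl(2) zero[of "\<lambda>x. 1"] by simp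
  next
    case (union B)
    have "(\<lambda>n. \<Sum>i\<in>I. c i * measure (M i) (K \<inter> B n)) sums (\<Sum>i\<in>I. c i * measure (M i) (\<Union>n. K \<inter> B n))"
    proof (intro sums_sum sums_mult)
      fix i assume i: "i \<in> I"
      have "disjoint_family (\<lambda>n. K \<inter> B n)"
        using union(1) by (auto simp: disjoint_family_on_def)
      moreover have "range (\<lambda>n. K \<inter> B n) \<subseteq> sets (M i)"
        using union(2) sets_M[OF i] by (auto simp: sigma)
      ultimately show "(\<lambda>n. measure (M i) (K \<inter> B n)) sums measure (M i) (\<Union>n. K \<inter> B n)"
        by (intro finite_measure.finite_measure_UNION M i)
    qed
    then show ?case
      using union(3) by (simp add: sums_iff)
  qed simp
  then show ?thesis
    by (simp add: B(2))
qed

section \<open>Local spectral measures\<close>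

context self_adjoint_operator
begin

text \<open>Both sides of the defining equation pass to uniform limits on the spectrum, so
  polynomials decide.\<close>

lemma is_local_spectral_measureI:
  assumes \<xi>: "\<xi> \<in> ell2 V" and \<mu>: "sets \<mu> = sets (restrict_space borel (spectrum V T))" "finite_measure \<mu>"
    and poly: "\<And>p. integral\<^sup>L \<mu> (poly p) = ell2_inner V (poly_operator p T \<xi>) \<xi>"
  shows "is_local_spectral_measure V T \<xi> \<mu>"
  unfolding is_local_spectral_measure_def
proof (intro conjI allI impI \<mu>)
  fix h :: "complex \<Rightarrow> complex" assume h: "continuous_on (spectrum V T) h"
  obtain p :: "nat \<Rightarrow> complex poly"
    where p: "uniform_limit (spectrum V T) (\<lambda>n. poly (p n)) h sequentially"
    using spectrum_poly_approximation[OF h] .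
  have "(\<lambda>n. integral\<^sup>L \<mu> (poly (p n))) \<longlonglongrightarrow> integral\<^sup>L \<mu> h"
    by (rule integral_uniform_limit[OF compact_spectrum \<mu>(2,1) _ h p]) (intro continuous_intros)
  moreover have "(\<lambda>n. integral\<^sup>L \<mu> (poly (p n))) \<longlonglongrightarrow> ell2_inner V (functional_calculus V T h \<xi>) \<xi>"
    unfolding poly by (rule functional_calculus_inner_limit[OF h p \<xi>])
  ultimately show "integral\<^sup>L \<mu> h = ell2_inner V (functional_calculus V T h \<xi>) \<xi>"
    by (rule LIMSEQ_unique)
qed

lemma poly_operator_of_real_inner:
  assumes "\<xi> \<in> ell2 V"
  shows "ell2_inner V (poly_operator (map_poly complex_of_real p) T \<xi>) \<xi>
    = complex_of_real (Re (ell2_inner V (poly_operator (map_poly complex_of_real p) T \<xi>) \<xi>))"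
proof -
  let ?P = "poly_operator (map_poly complex_of_real p) T \<xi>"
  have "map_poly cnj (map_poly complex_of_real p) = map_poly complex_of_real p"
    by (simp add: map_poly_map_poly o_def)
  then have "ell2_inner V ?P \<xi> = cnj (ell2_inner V ?P \<xi>)"
    using poly_operator_adjoint[OF assms assms, of "map_poly complex_of_real p"]
      ell2_inner_commute[of V \<xi> ?P] by simp
  then have "Im (ell2_inner V ?P \<xi>) = 0"
    by (metis Reals_cnj_iff complex_is_Real_iff)
  then show ?thesis
    by (simp add: complex_eq_iff)
qed

text \<open>Cauchy-Schwarz and \<open>poly_operator_norm_le\<close> bound
  \<open>\<bar>L p\<bar>\<close> by the squared norm of \<open>\<xi>\<close> times the supremum of
  \<open>p\<close>. As that squared norm is \<open>L 1\<close>, this is the hypothesis of the moment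
  problem.\<close>

lemma local_spectral_measure_exists:
  assumes \<xi>: "\<xi> \<in> ell2 V"
  shows "\<exists>\<mu>. is_local_spectral_measure V T \<xi> \<mu>"
proof -
  define L where "L p = Re (ell2_inner V (poly_operator (map_poly complex_of_real p) T \<xi>) \<xi>)" for p
  have inner_L: "ell2_inner V (poly_operator (map_poly complex_of_real p) T \<xi>) \<xi> = complex_of_real (L p)" for p
    unfolding L_def by (rule poly_operator_of_real_inner[OF \<xi>])
  have map_add: "map_poly complex_of_real (p + q) = map_poly complex_of_real p + map_poly complex_of_real q"
    for p q
    by (rule poly_eqI) (simp add: coeff_map_poly)
  have map_smult: "map_poly complex_of_real (smult c p) = smult (complex_of_real c) (map_poly complex_of_real p)"
    for c p
    by (rule poly_eqI) (simp add: coeff_map_poly)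
  have L_1: "L 1 = (ell2_norm V \<xi>)\<^sup>2"
    using \<xi> by (simp add: L_def ell2_inner_self)
  obtain M where M: "finite_measure M" "sets M = sets borel" "AE x in M. x \<in> real_spectrum"
    "\<And>p. integral\<^sup>L M (poly p) = L p"
  proof (rule compact_moment_problem[of L real_spectrum])
    show "L (p + q) = L p + L q" for p q
      using \<xi> by (simp add: L_def map_add poly_operator_add ell2_inner_add_left)
    show "L (smult c p) = c * L p" for c p
      by (simp add: L_def map_smult poly_operator_smult ell2_inner_scale_left)
    show "\<bar>L p\<bar> \<le> L 1 * e" if "0 \<le> e" and p: "\<And>x. x \<in> real_spectrum \<Longrightarrow> \<bar>poly p x\<bar> \<le> e" for p e
    proof -
      let ?P = "poly_operator (map_poly complex_of_real p) T \<xi>"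
      have "\<bar>L p\<bar> \<le> cmod (ell2_inner V ?P \<xi>)"
        unfolding L_def by (rule abs_Re_le_cmod)
      also have "\<dots> \<le> ell2_norm V ?P * ell2_norm V \<xi>"
        using \<xi> by (intro ell2_Cauchy_Schwarz) simp_all
      also have "ell2_norm V ?P \<le> e * ell2_norm V \<xi>"
      proof (rule poly_operator_norm_le[OF \<open>0 \<le> e\<close> _ \<xi>])
        fix z assume z: "z \<in> spectrum V T"
        obtain x where x: "x \<in> real_spectrum" "z = complex_of_real x"
          using spectrum_eq_of_real[OF z] .
        then show "cmod (poly (map_poly complex_of_real p) z) \<le> e"
          using p by (simp add: poly_map_poly_of_real)
      qed
      finally show ?thesis
        by (simp add: L_1 power2_eq_square mult_right_mono mult.commute mult.left_commute)
    qed
    show "compact real_spectrum"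
      by (rule compact_real_spectrum)
  qed (rule that)
  have K: "real_spectrum \<in> sets borel"
    using compact_real_spectrum by (simp add: borel_compact)
  \<comment> \<open>Restricting the measure to the real spectrum makes the embedding a map into the
    spectrum, so that the image has exactly the prescribed sigma-algebra.\<close>
  define M' where "M' = restrict_space M real_spectrum"
  have sets_M': "sets M' = sets (restrict_space borel real_spectrum)"
    unfolding M'_def by (rule sets_restrict_space_cong[OF M(2)])
  have space_M': "space M' = real_spectrum"
    by (rule space_eq_of_sets_restrict[OF sets_M'])
  have finite_M': "finite_measure M'"
    unfolding M'_def using K M by (intro finite_measure_restrict_space) simp_all
  have of_real: "complex_of_real \<in> measurable M' (restrict_space borel (spectrum V T))"
  proof (rule measurable_restrict_space2)
    show "complex_of_real \<in> space M' \<rightarrow> spectrum V T"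
      by (auto simp: space_M' real_spectrum_def)
    show "complex_of_real \<in> borel_measurable M'"
      by (intro measurable_continuous_restrict[OF sets_M'] continuous_intros)
  qed
  define \<mu> where "\<mu> = distr M' (restrict_space borel (spectrum V T)) complex_of_real"
  have sets_\<mu>: "sets \<mu> = sets (restrict_space borel (spectrum V T))"
    by (simp add: \<mu>_def)
  have finite_\<mu>: "finite_measure \<mu>"
    unfolding \<mu>_def by (rule finite_measure.finite_measure_distr[OF finite_M' of_real])
  have integral_real: "integral\<^sup>L \<mu> (poly (map_poly complex_of_real p)) = complex_of_real (L p)" for p
  proof -
    have "integral\<^sup>L \<mu> (poly (map_poly complex_of_real p))
      = (\<integral>x. poly (map_poly complex_of_real p) (complex_of_real x) \<partial>M')"
      unfolding \<mu>_def
      by (intro integral_distr of_real borel_measurable_continuous_on_restrict continuous_intros)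
    also have "\<dots> = complex_of_real (\<integral>x. poly p x \<partial>M')"
      by (simp add: poly_map_poly_of_real)
    also have "(\<integral>x. poly p x \<partial>M') = (\<integral>x. indicator real_spectrum x *\<^sub>R poly p x \<partial>M)"
      unfolding M'_def using K M(2) by (intro integral_restrict_space) simp
    also have "\<dots> = integral\<^sup>L M (poly p)"
    proof (rule integral_cong_AE)
      show "poly p \<in> borel_measurable M"
        unfolding measurable_cong_sets[OF M(2) refl]
        by (intro borel_measurable_continuous_onI continuous_intros)
      then show "(\<lambda>x. indicator real_spectrum x *\<^sub>R poly p x) \<in> borel_measurable M"
        using K M(2) by (intro borel_measurable_scaleR borel_measurable_indicator) simp_all
      show "AE x in M. indicator real_spectrum x *\<^sub>R poly p x = poly p x"
        using M(3) by eventually_elim simp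
    qed
    finally show ?thesis
      by (simp add: M(4))
  qed
  have "is_local_spectral_measure V T \<xi> \<mu>"
  proof (rule is_local_spectral_measureI[OF \<xi> sets_\<mu> finite_\<mu>])
    fix p :: "complex poly"
    \<comment> \<open>\<open>L\<close> knows real coefficients only; complex ones are split into
      real and imaginary parts, and both sides are complex linear in \<open>p\<close>.\<close>
    let ?r = "map_poly complex_of_real (map_poly Re p)"
    let ?i = "map_poly complex_of_real (map_poly Im p)"
    have p: "p = ?r + smult \<i> ?i"
      by (rule poly_eqI) (simp add: coeff_map_poly complex_eq)
    have int: "integrable \<mu> (poly q)" for q :: "complex poly"
      by (intro integrable_continuous_compact[OF compact_spectrum finite_\<mu> sets_\<mu>] continuous_intros)
    have "poly (?r + smult \<i> ?i) = (\<lambda>z. poly ?r z + \<i> * poly ?i z)"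
      by (simp add: fun_eq_iff)
    then have "integral\<^sup>L \<mu> (poly (?r + smult \<i> ?i)) = integral\<^sup>L \<mu> (poly ?r) + \<i> * integral\<^sup>L \<mu> (poly ?i)"
      using int by simp
    also have "\<dots> = ell2_inner V (poly_operator (?r + smult \<i> ?i) T \<xi>) \<xi>"
      using \<xi> unfolding integral_real
      by (simp add: poly_operator_add poly_operator_smult ell2_inner_add_left ell2_inner_scale_left inner_L)
    finally show "integral\<^sup>L \<mu> (poly p) = ell2_inner V (poly_operator p T \<xi>) \<xi>"
      by (simp only: p[symmetric])
  qed
  then show ?thesis ..
qed

lemma local_spectral_measure_real_integral:
  fixes g :: "complex \<Rightarrow> real"
  assumes "is_local_spectral_measure V T \<xi> \<mu>" "continuous_on (spectrum V T) g"
  shows "integral\<^sup>L \<mu> g = Re (ell2_inner V (functional_calculus V T (\<lambda>z. complex_of_real (g z)) \<xi>) \<xi>)"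
proof -
  have "continuous_on (spectrum V T) (\<lambda>z. complex_of_real (g z))"
    using assms(2) by (intro continuous_intros)
  then have "integral\<^sup>L \<mu> (\<lambda>z. complex_of_real (g z))
      = ell2_inner V (functional_calculus V T (\<lambda>z. complex_of_real (g z)) \<xi>) \<xi>"
    using assms(1) unfolding is_local_spectral_measure_def by blast
  from arg_cong[OF this, of Re] show ?thesis
    by simp
qed

lemma local_spectral_measure_unique:
  assumes \<mu>: "is_local_spectral_measure V T \<xi> \<mu>" and \<nu>: "is_local_spectral_measure V T \<xi> \<nu>"
  shows "\<mu> = \<nu>"
proof (rule measure_eqI)
  have \<mu>': "finite_measure \<mu>" "sets \<mu> = sets (restrict_space borel (spectrum V T))"
    and \<nu>': "finite_measure \<nu>" "sets \<nu> = sets (restrict_space borel (spectrum V T))"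
    using \<mu> \<nu> by (auto simp: is_local_spectral_measure_def)
  show "sets \<mu> = sets \<nu>"
    by (simp add: \<mu>' \<nu>')
  fix A assume A: "A \<in> sets \<mu>"
  \<comment> \<open>The difference of the two measures, written as a combination indexed by
    \<open>bool\<close>.\<close>
  have "(\<Sum>b\<in>UNIV. (if b then 1 else -1) * measure (if b then \<mu> else \<nu>) A) = 0"
  proof (rule measure_combination_eq_0[where K = "spectrum V T"])
    fix h :: "complex \<Rightarrow> real" assume h: "continuous_on (spectrum V T) h"
    show "(\<Sum>b\<in>UNIV. (if b then 1 else -1) * integral\<^sup>L (if b then \<mu> else \<nu>) h) = 0"
      using local_spectral_measure_real_integral[OF \<mu> h] local_spectral_measure_real_integral[OF \<nu> h]
      by (simp add: UNIV_bool)
  qed (use \<mu>' \<nu>' A in auto)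
  then have "measure \<mu> A = measure \<nu> A"
    by (simp add: UNIV_bool)
  then show "emeasure \<mu> A = emeasure \<nu> A"
    by (simp add: finite_measure.emeasure_eq_measure[OF \<mu>'(1)] finite_measure.emeasure_eq_measure[OF \<nu>'(1)])
qed

lemma is_local_spectral_measure:
  assumes "\<xi> \<in> ell2 V"
  shows "is_local_spectral_measure V T \<xi> (local_spectral_measure V T \<xi>)"
proof -
  have "\<exists>!\<mu>. is_local_spectral_measure V T \<xi> \<mu>"
    using local_spectral_measure_exists[OF assms] local_spectral_measure_unique by blast
  then show ?thesis
    unfolding local_spectral_measure_def by (rule theI')
qed

lemma
  assumes "\<xi> \<in> ell2 V"
  shows finite_local_spectral_measure: "finite_measure (local_spectral_measure V T \<xi>)"
    and sets_local_spectral_measure: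
      "sets (local_spectral_measure V T \<xi>) = sets (restrict_space borel (spectrum V T))"
  using is_local_spectral_measure[OF assms] by (auto simp: is_local_spectral_measure_def)

section \<open>Dependence of the measure on the vector\<close>

lemma measure_local_spectral_measure_le:
  assumes \<xi>: "\<xi> \<in> ell2 V"
  shows "measure (local_spectral_measure V T \<xi>) A \<le> (ell2_norm V \<xi>)\<^sup>2"
proof -
  let ?\<mu> = "local_spectral_measure V T \<xi>"
  \<comment> \<open>The constant function is the polynomial \<open>1\<close>, whose operator is the
    identity; the total mass is thus the squared norm.\<close>
  have 1: "(\<lambda>z. complex_of_real 1) = poly 1"
    by (simp add: fun_eq_iff)
  have "measure ?\<mu> A \<le> measure ?\<mu> (space ?\<mu>)"
    by (rule finite_measure.bounded_measure[OF finite_local_spectral_measure[OF \<xi>]])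
  also have "\<dots> = (\<integral>z. 1 \<partial>?\<mu>)"
    by simp
  also have "\<dots> = (ell2_norm V \<xi>)\<^sup>2"
    using \<xi> unfolding local_spectral_measure_real_integral[OF is_local_spectral_measure[OF \<xi>] continuous_on_const] 1
    by (subst functional_calculus_poly) (simp_all add: ell2_inner_self)
  finally show ?thesis .
qed

lemma measure_local_spectral_measure_scale:
  assumes \<xi>: "\<xi> \<in> ell2 V" and A: "A \<in> sets (restrict_space borel (spectrum V T))"
  shows "measure (local_spectral_measure V T (\<lambda>v. c * \<xi> v)) A
    = (cmod c)\<^sup>2 * measure (local_spectral_measure V T \<xi>) A"
proof -
  let ?\<mu> = "local_spectral_measure V T"
  let ?M = "\<lambda>b. if b then ?\<mu> (\<lambda>v. c * \<xi> v) else ?\<mu> \<xi>"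
  let ?c = "\<lambda>b. if b then 1 else - (cmod c)\<^sup>2"
  have \<xi>': "(\<lambda>v. c * \<xi> v) \<in> ell2 V"
    using \<xi> by simp
  have "(\<Sum>b\<in>UNIV. ?c b * measure (?M b) A) = 0"
  proof (rule measure_combination_eq_0[where K = "spectrum V T"])
    fix h :: "complex \<Rightarrow> real" assume h: "continuous_on (spectrum V T) h"
    let ?S = "functional_calculus V T (\<lambda>z. complex_of_real (h z))"
    have S: "bounded_operator V ?S"
      using h by (intro bounded_functional_calculus continuous_intros)
    have "ell2_inner V (?S (\<lambda>v. c * \<xi> v)) (\<lambda>v. c * \<xi> v)
      = complex_of_real ((cmod c)\<^sup>2) * ell2_inner V (?S \<xi>) \<xi>"
      using \<xi> unfolding complex_norm_square
      by (simp add: bounded_operator_scale[OF S] ell2_inner_scale_left ell2_inner_scale_right)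
    then show "(\<Sum>b\<in>UNIV. ?c b * integral\<^sup>L (?M b) h) = 0"
      using local_spectral_measure_real_integral[OF is_local_spectral_measure[OF \<xi>] h]
        local_spectral_measure_real_integral[OF is_local_spectral_measure[OF \<xi>'] h]
      by (simp add: UNIV_bool)
  qed (use \<xi> \<xi>' A in \<open>auto simp: sets_local_spectral_measure finite_local_spectral_measure\<close>)
  then show ?thesis
    by (simp add: UNIV_bool)
qed

text \<open>For each fixed \<open>h\<close> the integral is a quadratic form in the vector; its
  parallelogram law is a relation between four measures with weights 1, 1, -2, -2.\<close>

lemma measure_local_spectral_measure_parallelogram:
  assumes \<xi>: "\<xi> \<in> ell2 V" and \<eta>: "\<eta> \<in> ell2 V"
    and A: "A \<in> sets (restrict_space borel (spectrum V T))"
  shows "measure (local_spectral_measure V T (\<lambda>v. \<xi> v + \<eta> v)) A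
      + measure (local_spectral_measure V T (\<lambda>v. \<xi> v - \<eta> v)) A
    = 2 * measure (local_spectral_measure V T \<xi>) A + 2 * measure (local_spectral_measure V T \<eta>) A"
proof -
  define x where "x = (!) [\<lambda>v. \<xi> v + \<eta> v, \<lambda>v. \<xi> v - \<eta> v, \<xi>, \<eta>]"
  define c where "c = (!) [1, 1, -2, -2 :: real]"
  have set: "{..<4} = {0, 1, 2, 3 :: nat}"
    by auto
  have x: "x i \<in> ell2 V" if "i \<in> {..<4}" for i
    using that \<xi> \<eta> unfolding set by (auto simp: x_def)
  have "(\<Sum>i<4. c i * measure (local_spectral_measure V T (x i)) A) = 0"
  proof (rule measure_combination_eq_0[where K = "spectrum V T"])
    fix h :: "complex \<Rightarrow> real" assume h: "continuous_on (spectrum V T) h"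
    let ?S = "functional_calculus V T (\<lambda>z. complex_of_real (h z))"
    have S: "bounded_operator V ?S"
      using h by (intro bounded_functional_calculus continuous_intros)
    note S_simps = bounded_operator_add[OF S] bounded_operator_diff[OF S] bounded_operator_closed[OF S]
    have "(\<Sum>i<4. c i * integral\<^sup>L (local_spectral_measure V T (x i)) h)
      = (\<Sum>i<4. c i * Re (ell2_inner V (?S (x i)) (x i)))"
      using local_spectral_measure_real_integral[OF is_local_spectral_measure[OF x] h]
      by (intro sum.cong) simp_all
    also have "\<dots> = 0"
      using \<xi> \<eta> unfolding set
      by (simp add: x_def c_def S_simps ell2_inner_add_left ell2_inner_add_right
          ell2_inner_diff_left ell2_inner_diff_right)
    finally show "(\<Sum>i<4. c i * integral\<^sup>L (local_spectral_measure V T (x i)) h) = 0" .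
  qed (use x A in \<open>auto simp: sets_local_spectral_measure finite_local_spectral_measure\<close>)
  then show ?thesis
    unfolding set by (simp add: x_def c_def)
qed

text \<open>The substitute for additivity, obtained by dropping the nonnegative term of the
  difference.\<close>

lemma measure_local_spectral_measure_add_le:
  assumes "\<xi> \<in> ell2 V" "\<eta> \<in> ell2 V" "A \<in> sets (restrict_space borel (spectrum V T))"
  shows "measure (local_spectral_measure V T (\<lambda>v. \<xi> v + \<eta> v)) A
    \<le> 2 * measure (local_spectral_measure V T \<xi>) A + 2 * measure (local_spectral_measure V T \<eta>) A"
  using measure_local_spectral_measure_parallelogram[OF assms]
    measure_nonneg[of "local_spectral_measure V T (\<lambda>v. \<xi> v - \<eta> v)" A] by linarith

theorem local_spectral_measure_null:
  assumes A: "A \<in> sets (restrict_space borel (spectrum V T))"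
    and null: "\<And>v. v \<in> V \<Longrightarrow> measure (local_spectral_measure V T (delta v)) A = 0"
    and \<eta>: "\<eta> \<in> ell2 V"
  shows "measure (local_spectral_measure V T \<eta>) A = 0"
proof -
  let ?m = "\<lambda>\<xi>. measure (local_spectral_measure V T \<xi>) A"
  have finite: "?m (\<lambda>v. \<Sum>w\<in>F. \<eta> w * delta w v) = 0" if "finite F" "F \<subseteq> V" for F
    using that
  proof (induction F)
    case empty
    then show ?case
      using measure_local_spectral_measure_le[of "\<lambda>v. 0" A] by (simp add: antisym)
  next
    case (insert w F)
    have *: "delta u \<in> ell2 V" if "u \<in> insert w F" for u
      using insert.prems that by (intro ell2_delta) auto
    then have "(\<lambda>v. \<Sum>u\<in>F. \<eta> u * delta u v) \<in> ell2 V"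
      by (intro ell2_sum ell2_scale) simp
    moreover have "?m (\<lambda>v. \<eta> w * delta w v) = 0"
      using insert.prems * by (subst measure_local_spectral_measure_scale[OF _ A]) (simp_all add: null)
    ultimately show ?case
      using measure_local_spectral_measure_add_le[of "\<lambda>v. \<eta> w * delta w v"
          "\<lambda>v. \<Sum>u\<in>F. \<eta> u * delta u v" A] insert * A
      by (simp add: antisym)
  qed
  have "?m \<eta> \<le> 0 + e" if "e > 0" for e
  proof -
    \<comment> \<open>The finite part \<open>?\<xi>\<close> contributes nothing, and the remainder
      contributes at most twice its squared norm, that is, at most \<open>e\<close>.\<close>
    have "sqrt (e / 2) > 0"
      using that by simp
    from ell2_finite_approximation[OF \<eta> this] obtain F where F: "finite F" "F \<subseteq> V"
      "ell2_norm V (\<lambda>v. \<eta> v - (\<Sum>w\<in>F. \<eta> w * delta w v)) \<le> sqrt (e / 2)" .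
    let ?\<xi> = "\<lambda>v. \<Sum>w\<in>F. \<eta> w * delta w v"
    let ?\<zeta> = "\<lambda>v. \<eta> v - ?\<xi> v"
    have \<xi>: "?\<xi> \<in> ell2 V"
      using F(2) by (intro ell2_sum ell2_scale ell2_delta) auto
    then have \<zeta>: "?\<zeta> \<in> ell2 V"
      using \<eta> by simp
    have "?m \<eta> \<le> 2 * ?m ?\<xi> + 2 * ?m ?\<zeta>"
      using measure_local_spectral_measure_add_le[OF \<xi> \<zeta> A] by simp
    also have "?m ?\<zeta> \<le> (ell2_norm V ?\<zeta>)\<^sup>2"
      by (rule measure_local_spectral_measure_le[OF \<zeta>])
    also have "\<dots> \<le> (sqrt (e / 2))\<^sup>2"
      by (rule power_mono[OF F(3)]) simp
    finally show ?thesis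
      using finite[OF F(1,2)] that by simp
  qed
  then have "?m \<eta> \<le> 0"
    by (rule field_le_epsilon)
  then show ?thesis
    by (simp add: antisym)
qed

text \<open>Against \<open>delta v\<close> the polynomial moments are combinations of the diagonal
  coefficients. Equal diagonals let the measure at \<open>v\<close> satisfy the characterisation of
  the one at \<open>w\<close>.\<close>

lemma local_spectral_measure_delta_cong:
  assumes "v \<in> V" "w \<in> V" and eq: "\<And>n. (T ^^ n) (delta v) v = (T ^^ n) (delta w) w"
  shows "local_spectral_measure V T (delta v) = local_spectral_measure V T (delta w)"
proof -
  have \<delta>: "delta v \<in> ell2 V" "delta w \<in> ell2 V"
    using assms by (auto intro: ell2_delta)
  have "ell2_inner V (poly_operator p T (delta v)) (delta v)
      = ell2_inner V (poly_operator p T (delta w)) (delta w)" for p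
    by (simp add: ell2_inner_delta assms(1,2) poly_operator_def eq)
  moreover have "integral\<^sup>L (local_spectral_measure V T (delta v)) (poly p)
      = ell2_inner V (poly_operator p T (delta v)) (delta v)" for p
    using is_local_spectral_measure[OF \<delta>(1)] functional_calculus_poly[OF \<delta>(1), of p]
    by (simp add: is_local_spectral_measure_def continuous_intros)
  ultimately have "is_local_spectral_measure V T (delta w) (local_spectral_measure V T (delta v))"
    by (intro is_local_spectral_measureI \<delta> sets_local_spectral_measure finite_local_spectral_measure) simp
  then show ?thesis
    using is_local_spectral_measure[OF \<delta>(2)] by (rule local_spectral_measure_unique)
qed

end

section \<open>The adjacency operator\<close>

definition neighbours :: "'a set \<Rightarrow> 'a set set \<Rightarrow> 'a \<Rightarrow> 'a set" where
  "neighbours V E v = {w \<in> V. {v, w} \<in> E}"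

lemma neighbours_commute: "v \<in> V \<Longrightarrow> w \<in> V \<Longrightarrow> v \<in> neighbours V E w \<longleftrightarrow> w \<in> neighbours V E v"
  by (simp add: neighbours_def insert_commute)

lemma adjacency_operator_eq:
  "adjacency_operator V E f = (\<lambda>v. if v \<in> V then \<Sum>w\<in>neighbours V E v. f w else 0)"
  unfolding adjacency_operator_def neighbours_def ..

lemma bounded_degree_neighbours:
  assumes "bounded_degree V E"
  obtains d where "\<And>v. v \<in> V \<Longrightarrow> finite (neighbours V E v)"
    "\<And>v. v \<in> V \<Longrightarrow> card (neighbours V E v) \<le> d"
proof -
  obtain d where d: "\<And>v. v \<in> V \<Longrightarrow> finite {e \<in> E. v \<in> e}" "\<And>v. v \<in> V \<Longrightarrow> card {e \<in> E. v \<in> e} \<le> d"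
    using assms by (auto simp: bounded_degree_def)
  have inj: "inj_on (\<lambda>w. {v, w}) (neighbours V E v)"
    and image: "(\<lambda>w. {v, w}) ` neighbours V E v \<subseteq> {e \<in> E. v \<in> e}" for v
    by (auto simp: inj_on_def neighbours_def doubleton_eq_iff)
  show ?thesis
  proof
    fix v assume v: "v \<in> V"
    show "finite (neighbours V E v)"
      using finite_imageD[OF finite_subset[OF image d(1)[OF v]] inj] .
    show "card (neighbours V E v) \<le> d"
      using card_inj_on_le[OF inj image d(1)[OF v]] d(2)[OF v] by linarith
  qed
qed

text \<open>A Schur test: Cauchy-Schwarz over at most \<open>d\<close> neighbours gives one factor
  \<open>d\<close>; after exchanging the sums each \<open>w\<close> is counted at most
  \<open>d\<close> times by symmetry of adjacency, which gives the other.\<close>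

lemma bounded_adjacency_operator:
  assumes "bounded_degree V E"
  shows "bounded_operator V (adjacency_operator V E)"
proof -
  let ?A = "adjacency_operator V E" and ?N = "neighbours V E"
  obtain d where fin: "\<And>v. v \<in> V \<Longrightarrow> finite (?N v)" and d: "\<And>v. v \<in> V \<Longrightarrow> card (?N v) \<le> d"
    using bounded_degree_neighbours[OF assms] by metis
  have outside: "?A f v = 0" if "v \<notin> V" for f v
    using that by (simp add: adjacency_operator_def)
  have sums: "(\<Sum>v\<in>F. (cmod (?A f v))\<^sup>2) \<le> (real d * ell2_norm V f)\<^sup>2"
    if f: "f \<in> ell2 V" and F: "finite F" "F \<subseteq> V" for f F
  proof -
    define G where "G = (\<Union>v\<in>F. ?N v)"
    have G: "finite G" "G \<subseteq> V"
      using F fin by (auto simp: G_def neighbours_def)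
    have "(cmod (?A f v))\<^sup>2 \<le> real d * (\<Sum>w\<in>?N v. (cmod (f w))\<^sup>2)" if "v \<in> F" for v
    proof -
      have v: "v \<in> V"
        using that F by auto
      have "(cmod (?A f v))\<^sup>2 \<le> (\<Sum>w\<in>?N v. cmod (f w))\<^sup>2"
        using v by (intro power_mono) (simp_all add: adjacency_operator_eq norm_sum)
      also have "\<dots> \<le> (\<Sum>w\<in>?N v. (cmod (f w))\<^sup>2) * card (?N v)"
        by (rule sum_squared_le_sum_of_squares)
      also have "\<dots> \<le> (\<Sum>w\<in>?N v. (cmod (f w))\<^sup>2) * d"
        using d[OF v] by (intro mult_left_mono sum_nonneg) auto
      finally show ?thesis
        by (simp add: mult.commute)
    qed
    then have "(\<Sum>v\<in>F. (cmod (?A f v))\<^sup>2) \<le> (\<Sum>v\<in>F. real d * (\<Sum>w\<in>?N v. (cmod (f w))\<^sup>2))"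
      by (rule sum_mono)
    also have "\<dots> = real d * (\<Sum>v\<in>F. \<Sum>w | w \<in> G \<and> w \<in> ?N v. (cmod (f w))\<^sup>2)"
      unfolding sum_distrib_left[symmetric]
      by (intro arg_cong[where f = "(*) (real d)"] sum.cong refl) (auto simp: G_def)
    also have "(\<Sum>v\<in>F. \<Sum>w | w \<in> G \<and> w \<in> ?N v. (cmod (f w))\<^sup>2)
        = (\<Sum>w\<in>G. \<Sum>v | v \<in> F \<and> w \<in> ?N v. (cmod (f w))\<^sup>2)"
      using F(1) G(1) by (rule sum.swap_restrict)
    also have "\<dots> \<le> (\<Sum>w\<in>G. real d * (cmod (f w))\<^sup>2)"
    proof (rule sum_mono)
      fix w assume "w \<in> G"
      then have w: "w \<in> V"
        using G by auto
      have "card {v. v \<in> F \<and> w \<in> ?N v} \<le> card (?N w)"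
        using F w by (intro card_mono fin) (auto simp: neighbours_commute[of w])
      then have "card {v. v \<in> F \<and> w \<in> ?N v} \<le> d"
        using d[OF w] by linarith
      then show "(\<Sum>v | v \<in> F \<and> w \<in> ?N v. (cmod (f w))\<^sup>2) \<le> real d * (cmod (f w))\<^sup>2"
        by (simp add: mult_right_mono)
    qed
    also have "\<dots> = real d * (\<Sum>w\<in>G. (cmod (f w))\<^sup>2)"
      by (simp add: sum_distrib_left)
    also have "\<dots> \<le> real d * (ell2_norm V f)\<^sup>2"
      using ell2_finite_sum_le[OF f G] by (intro mult_left_mono) auto
    finally show ?thesis
      by (simp add: power_mult_distrib power2_eq_square mult.assoc mult.left_commute mult_left_mono)
  qed
  have bound: "?A f \<in> ell2 V" "ell2_norm V (?A f) \<le> real d * ell2_norm V f" if "f \<in> ell2 V" for f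
    using ell2_bounded_sums[of V "?A f" "real d * ell2_norm V f", OF outside sums[OF that]] by simp_all
  show ?thesis
    unfolding bounded_operator_def
  proof (intro conjI ballI allI)
    show "?A (\<lambda>v. f v + g v) = (\<lambda>v. ?A f v + ?A g v)" for f g
      by (simp add: adjacency_operator_def fun_eq_iff sum.distrib)
    show "?A (\<lambda>v. c * f v) = (\<lambda>v. c * ?A f v)" for c f
      by (simp add: adjacency_operator_def fun_eq_iff sum_distrib_left)
    show "\<exists>C. \<forall>f\<in>ell2 V. ell2_norm V (?A f) \<le> C * ell2_norm V f"
      using bound(2) by blast
  qed (rule bound(1))
qed

lemma adjacency_operator_delta_inner:
  assumes E: "bounded_degree V E" and v: "v \<in> V"
  shows "ell2_inner V (adjacency_operator V E f) (delta v)
    = ell2_inner V f (adjacency_operator V E (delta v))"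
proof -
  let ?N = "neighbours V E"
  have fin: "finite (?N w)" if "w \<in> V" for w
    using bounded_degree_neighbours[OF E] that by metis
  have A_delta: "adjacency_operator V E (delta v) w = (if w \<in> ?N v then 1 else 0)" for w
  proof (cases "w \<in> V")
    case True
    then show ?thesis
      using fin[OF True] v
      by (simp add: adjacency_operator_eq delta_def sum.delta neighbours_commute[of v V w])
  qed (simp add: adjacency_operator_def neighbours_def)
  have "ell2_inner V f (adjacency_operator V E (delta v)) = (\<Sum>\<^sub>\<infinity>w\<in>?N v. f w)"
    unfolding ell2_inner_def A_delta by (rule infsum_cong_neutral) (auto simp: neighbours_def)
  also have "\<dots> = adjacency_operator V E f v"
    using v fin[OF v] by (simp add: adjacency_operator_eq)
  finally show ?thesis
    by (simp add: ell2_inner_delta[OF v])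
qed

text \<open>For fixed \<open>f\<close> the defect \<open>D\<close> is conjugate linear, bounded, and
  zero at every \<open>delta w\<close>; by density it vanishes. No infinite double sum has to be
  rearranged.\<close>

lemma self_adjoint_adjacency_operator:
  assumes E: "bounded_degree V E"
  shows "self_adjoint_operator V (adjacency_operator V E)"
proof
  let ?A = "adjacency_operator V E"
  show A: "bounded_operator V ?A"
    by (rule bounded_adjacency_operator[OF E])
  note closed = bounded_operator_closed[OF A]
  fix f g assume f: "f \<in> ell2 V" and g: "g \<in> ell2 V"
  define D where "D h = ell2_inner V (?A f) h - ell2_inner V f (?A h)" for h
  have D_add: "D (\<lambda>v. h v + k v) = D h + D k" if "h \<in> ell2 V" "k \<in> ell2 V" for h k
    using that f by (simp add: D_def bounded_operator_add[OF A] ell2_inner_add_right closed)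
  have D_scale: "D (\<lambda>v. c * h v) = cnj c * D h" if "h \<in> ell2 V" for c h
    using that by (simp add: D_def bounded_operator_scale[OF A] ell2_inner_scale_right right_diff_distrib)
  have D_finite: "D (\<lambda>v. \<Sum>w\<in>F. g w * delta w v) = 0" if "finite F" "F \<subseteq> V" for F
    using that
  proof (induction F)
    case empty
    then show ?case
      using D_scale[of "\<lambda>v. 0" 0] by simp
  next
    case (insert w F)
    have "(\<lambda>v. \<Sum>u\<in>F. g u * delta u v) \<in> ell2 V"
      using insert.prems by (intro ell2_sum ell2_scale ell2_delta) auto
    moreover have "D (delta w) = 0"
      using insert.prems by (simp add: D_def adjacency_operator_delta_inner[OF E])
    ultimately show ?case
      using insert by (simp add: D_add D_scale ell2_delta)
  qed
  obtain C where C: "C > 0" "\<And>h. h \<in> ell2 V \<Longrightarrow> ell2_norm V (?A h) \<le> C * ell2_norm V h"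
    using bounded_operator_bound[OF A] by metis
  have "cmod (D g) \<le> 0 + e" if "e > 0" for e
  proof -
    \<comment> \<open>Twice \<open>C * ell2_norm V f\<close> bounds the defect relative to its
      argument; the added 1 keeps the divisor positive.\<close>
    define k where "k = 2 * C * ell2_norm V f + 1"
    have k: "k > 0"
      using C(1) unfolding k_def by (intro add_nonneg_pos mult_nonneg_nonneg) auto
    then have "e / k > 0"
      using that by simp
    from ell2_finite_approximation[OF g this] obtain F where F: "finite F" "F \<subseteq> V"
      "ell2_norm V (\<lambda>v. g v - (\<Sum>w\<in>F. g w * delta w v)) \<le> e / k" .
    let ?s = "\<lambda>v. \<Sum>w\<in>F. g w * delta w v"
    let ?h = "\<lambda>v. g v - ?s v"
    have s: "?s \<in> ell2 V"
      using F(2) by (intro ell2_sum ell2_scale ell2_delta) auto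
    then have h: "?h \<in> ell2 V"
      using g by simp
    have "D g = D ?h"
      using D_add[OF h s] D_finite[OF F(1,2)] by simp
    also have "cmod \<dots> \<le> cmod (ell2_inner V (?A f) ?h) + cmod (ell2_inner V f (?A ?h))"
      unfolding D_def by (rule norm_triangle_ineq4)
    also have "\<dots> \<le> ell2_norm V (?A f) * ell2_norm V ?h + ell2_norm V f * ell2_norm V (?A ?h)"
      using f h by (intro add_mono ell2_Cauchy_Schwarz closed)
    also have "\<dots> \<le> (C * ell2_norm V f) * ell2_norm V ?h + ell2_norm V f * (C * ell2_norm V ?h)"
      using f h by (intro add_mono mult_right_mono mult_left_mono C(2)) simp_all
    also have "\<dots> \<le> k * ell2_norm V ?h"
      by (simp add: k_def algebra_simps)
    also have "\<dots> \<le> k * (e / k)"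
      using F(3) k by (intro mult_left_mono) simp_all
    also have "\<dots> = e"
      using k by simp
    finally show ?thesis
      by simp
  qed
  then have "cmod (D g) \<le> 0"
    by (rule field_le_epsilon)
  then show "ell2_inner V (?A f) g = ell2_inner V f (?A g)"
    by (simp add: D_def)
qed

section \<open>Closed walks\<close>

text \<open>Two free endpoints, since removing the first vertex of a closed walk generally leaves a
  walk that is not closed.\<close>

definition walks :: "'a set \<Rightarrow> 'a set set \<Rightarrow> nat \<Rightarrow> 'a \<Rightarrow> 'a \<Rightarrow> 'a list set" where
  "walks V E n u v =
     {p. length p = Suc n \<and> set p \<subseteq> V \<and> hd p = u \<and> last p = v \<and> (\<forall>i<n. {p ! i, p ! Suc i} \<in> E)}"

lemma walks_0: "walks V E 0 u v = (if u = v \<and> u \<in> V then {[u]} else {})"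
  by (auto simp: walks_def length_Suc_conv)

lemma walks_Suc:
  assumes "u \<in> V"
  shows "walks V E (Suc n) u v = (#) u ` (\<Union>w\<in>neighbours V E u. walks V E n w v)"
proof (intro equalityI subsetI)
  fix p assume p: "p \<in> walks V E (Suc n) u v"
  then obtain w q where pq: "p = u # w # q"
    by (auto simp: walks_def length_Suc_conv)
  have "{u, w} \<in> E"
    using p unfolding walks_def pq by force
  moreover have "{(w # q) ! i, (w # q) ! Suc i} \<in> E" if "i < n" for i
    using p that unfolding walks_def pq by force
  ultimately show "p \<in> (#) u ` (\<Union>w\<in>neighbours V E u. walks V E n w v)"
    using p by (auto simp: pq walks_def neighbours_def)
next
  fix p assume "p \<in> (#) u ` (\<Union>w\<in>neighbours V E u. walks V E n w v)"
  then obtain w q where w: "w \<in> neighbours V E u" "q \<in> walks V E n w v" "p = u # q"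
    by blast
  then have "q \<noteq> []" "hd q = w"
    by (auto simp: walks_def)
  then have "q ! 0 = w"
    by (simp add: hd_conv_nth)
  then have "{p ! i, p ! Suc i} \<in> E" if "i < Suc n" for i
    using w that \<open>q ! 0 = w\<close> by (cases i) (auto simp: walks_def neighbours_def)
  then show "p \<in> walks V E (Suc n) u v"
    using w \<open>q \<noteq> []\<close> assms by (simp add: walks_def)
qed

text \<open>Counting a disjoint union with \<open>card\<close> requires finite sets, so finiteness
  is carried through the same induction.\<close>

lemma adjacency_operator_power_delta:
  assumes "bounded_degree V E" "v \<in> V" "u \<in> V"
  shows "finite (walks V E n u v)"
    and "(adjacency_operator V E ^^ n) (delta v) u = of_nat (card (walks V E n u v))"
proof -
  have "finite (walks V E n u v) \<and>
      (adjacency_operator V E ^^ n) (delta v) u = of_nat (card (walks V E n u v))"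
    using assms(3)
  proof (induction n arbitrary: u)
    case 0
    then show ?case
      by (simp add: walks_0 delta_def)
  next
    case (Suc n)
    have fin: "finite (neighbours V E u)"
      using bounded_degree_neighbours[OF assms(1)] Suc.prems by metis
    have IH: "finite (walks V E n w v)"
      "(adjacency_operator V E ^^ n) (delta v) w = of_nat (card (walks V E n w v))"
      if "w \<in> neighbours V E u" for w
      using Suc.IH that by (auto simp: neighbours_def)
    have "card (walks V E (Suc n) u v) = card (\<Union>w\<in>neighbours V E u. walks V E n w v)"
      unfolding walks_Suc[OF Suc.prems] by (rule card_image) simp
    \<comment> \<open>Walks starting at different neighbours differ in their heads, so the union is
      disjoint.\<close>
    also have "\<dots> = (\<Sum>w\<in>neighbours V E u. card (walks V E n w v))"
      using fin IH(1) by (intro card_UN_disjoint) (auto simp: walks_def)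
    finally have "of_nat (card (walks V E (Suc n) u v))
        = (\<Sum>w\<in>neighbours V E u. (adjacency_operator V E ^^ n) (delta v) w)"
      by (simp add: IH(2))
    moreover have "(adjacency_operator V E ^^ Suc n) (delta v) u
        = (\<Sum>w\<in>neighbours V E u. (adjacency_operator V E ^^ n) (delta v) w)"
      using Suc.prems by (simp add: adjacency_operator_eq[of V E "(adjacency_operator V E ^^ n) (delta v)"])
    moreover have "finite (walks V E (Suc n) u v)"
      using fin IH(1) by (simp add: walks_Suc[OF Suc.prems])
    ultimately show ?case
      by simp
  qed
  then show "finite (walks V E n u v)"
    and "(adjacency_operator V E ^^ n) (delta v) u = of_nat (card (walks V E n u v))"
    by auto
qed

theorem proposition3p7:
  fixes V :: "'a set" and E :: "'a set set"
  assumes "countable_graph V E"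
    and "bounded_degree V E"
    and "walk_regular V E"
  shows "\<forall>v\<in>V. dominant V E v"
proof
  fix v assume v: "v \<in> V"
  let ?A = "adjacency_operator V E"
  interpret self_adjoint_operator V ?A
    by (rule self_adjoint_adjacency_operator[OF assms(2)])
  have walks: "(?A ^^ n) (delta w) w = of_nat (card (closed_walks V E n w))" if "w \<in> V" for w n
    using adjacency_operator_power_delta(2)[OF assms(2) that that]
    by (simp add: closed_walks_def walks_def)
  have same: "local_spectral_measure V ?A (delta w) = local_spectral_measure V ?A (delta v)" if w: "w \<in> V" for w
  proof (rule local_spectral_measure_delta_cong[OF w v])
    show "(?A ^^ n) (delta w) w = (?A ^^ n) (delta v) v" for n
      using assms(3) v w unfolding walk_regular_def walks[OF v] walks[OF w] by metis
  qed
  have \<delta>: "delta v \<in> ell2 V"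
    using v by (rule ell2_delta)
  show "dominant V E v"
    unfolding dominant_def absolutely_continuous_def
  proof (intro ballI subsetI)
    fix \<eta> A assume \<eta>: "\<eta> \<in> ell2 V"
      and A: "A \<in> null_sets (local_spectral_measure V ?A (delta v))"
    have sets_A: "A \<in> sets (restrict_space borel (spectrum V ?A))"
      using A by (auto simp: null_sets_def sets_local_spectral_measure[OF \<delta>])
    \<comment> \<open>Walk-regularity enters only here, through \<open>same\<close>: nullity at the
      one vertex \<open>v\<close> becomes nullity at all vertices.\<close>
    have "measure (local_spectral_measure V ?A (delta w)) A = 0" if "w \<in> V" for w
      using A by (simp add: same[OF that] measure_eq_0_null_sets)
    then have "measure (local_spectral_measure V ?A \<eta>) A = 0"
      by (rule local_spectral_measure_null[OF sets_A _ \<eta>])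
    then show "A \<in> null_sets (local_spectral_measure V ?A \<eta>)"
      using sets_A
      by (simp add: null_sets_def sets_local_spectral_measure[OF \<eta>]
          finite_measure.emeasure_eq_measure[OF finite_local_spectral_measure[OF \<eta>]])
  qed
qed

end
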